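(* Let $(\mathcal{X},d)$ be a Polish geodesic metric space, $\mu$ a Borel probability measure on $\mathcal{X}$ and $\alpha:[0,\infty)\to[0,\infty)$ a non-increasing function. If $\mu$ satisfies the dimension free convex concentration property $\mathbf{CCI}_2^\infty(\alpha)$, then $\mu$ satisfies the convex Poincaré inequality $$\lambda\,\mathrm{Var}_\mu(f)\le\int|\nabla^-f|^2\,d\mu$$ for all locally Lipschitz and convex functions $f:\mathcal{X}\to\mathbb{R}$ with finite variance under $\mu$, with the constant $\lambda$ defined by $$\sqrt{\lambda}=\sup\left\{\frac{\overline{\Phi}^{-1}(\alpha(r))}{r}\;;\;r>0\text{ such that }\alpha(r)\le1/2\right\}.$$ If moreover $\int_0^\infty r\alpha(r)\,dr<\infty$, then the variance under $\mu$ of every convex and Lipschitz function is finite, and thus $$\lambda\,\mathrm{Var}_\mu(f)\le\int|\nabla^-f|^2\,d\mu\qquad\text{for all } f:\mathcal{X}\to\mathbb{R}\text{ Lipschitz and convex}.$$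
   Context: A metric space is geodesic if any two points $x,y$ are joined by a (constant-speed) geodesic, i.e. a curve $(x_t)_{t\in[0,1]}$ with $x_0=x$, $x_1=y$ and $d(x_s,x_t)=|t-s|\,d(x_0,x_1)$ for all $s,t\in[0,1]$. A set $A$ is convex if for all $x_0,x_1\in A$ and all geodesics $(x_t)_{t\in[0,1]}$ joining $x_0$ to $x_1$, $x_t\in A$ for all $t$. A function $f$ with values in $\mathbb{R}\cup\{+\infty\}$ is convex if $f(x_t)\le(1-t)f(x_0)+tf(x_1)$ for all geodesics $(x_t)_{t\in[0,1]}$ and all $t\in[0,1]$. Locally Lipschitz means Lipschitz on every ball of finite radius. For $n\ge1$, $\mathcal{X}^n$ carries the distance $d_2(x,y)=\left(\sum_{i=1}^nd(x_i,y_i)^2\right)^{1/2}$ (for which it is again geodesic) and the product measure $\mu^n$; for $A\subset\mathcal{X}^n$, $A_{r,2}=\{x\in\mathcal{X}^n:d_2(x,A)\le r\}$. The measure $\mu$ satisfies $\mathbf{CCI}_2^\infty(\alpha)$ if for every $n\ge1$ and every convex (Borel) $A\subset\mathcal{X}^n$ with $\mu^n(A)\ge1/2$, $\mu^n(A_{r,2})\ge1-\alpha(r)$ for all $r\ge0$. $|\nabla^-f|(x)=\limsup_{y\to x}\frac{[f(y)-f(x)]_-}{d(y,x)}$ if $x$ is not isolated, where $[u]_-=\max(-u,0)$, and $|\nabla^-f|(x)=0$ if $x$ is isolated. $\overline{\Phi}(x)=\frac1{\sqrt{2\pi}}\int_x^{+\infty}e^{-u^2/2}\,du$, $\overline\Phi^{-1}$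 is its inverse with $\overline\Phi^{-1}(0)=+\infty$; the supremum of the empty set is $0$, and $\infty\times0=0$. *)

theory Defs
  imports "HOL-Probability.Probability"
begin

text \<open>
  The geodesic notions take an explicit carrier \<open>M\<close> and distance \<open>d\<close>, because they are needed both
  for the base space (\<open>UNIV\<close> with \<open>dist\<close>) and for its \<open>n\<close>-fold products, where \<open>n\<close> is quantified
  inside the concentration property.  Values of a curve outside \<open>[0,1]\<close> are irrelevant.
\<close>

definition geodesic_curve :: "'a set \<Rightarrow> ('a \<Rightarrow> 'a \<Rightarrow> real) \<Rightarrow> (real \<Rightarrow> 'a) \<Rightarrow> bool" where
  "geodesic_curve M d \<gamma> \<longleftrightarrow>
     (\<forall>t\<in>{0..1}. \<gamma> t \<in> M) \<and>
     (\<forall>s\<in>{0..1}. \<forall>t\<in>{0..1}. d (\<gamma> s) (\<gamma> t) = \<bar>t - s\<bar> * d (\<gamma> 0) (\<gamma> 1))"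

definition geodesic_metric :: "'a set \<Rightarrow> ('a \<Rightarrow> 'a \<Rightarrow> real) \<Rightarrow> bool" where
  "geodesic_metric M d \<longleftrightarrow>
     (\<forall>x\<in>M. \<forall>y\<in>M. \<exists>\<gamma>. geodesic_curve M d \<gamma> \<and> \<gamma> 0 = x \<and> \<gamma> 1 = y)"

definition geod_convex_set :: "'a set \<Rightarrow> ('a \<Rightarrow> 'a \<Rightarrow> real) \<Rightarrow> 'a set \<Rightarrow> bool" where
  "geod_convex_set M d A \<longleftrightarrow>
     A \<subseteq> M \<and>
     (\<forall>\<gamma>. geodesic_curve M d \<gamma> \<and> \<gamma> 0 \<in> A \<and> \<gamma> 1 \<in> A \<longrightarrow> (\<forall>t\<in>{0..1}. \<gamma> t \<in> A))"

definition geod_convex_fun :: "'a set \<Rightarrow> ('a \<Rightarrow> 'a \<Rightarrow> real) \<Rightarrow> ('a \<Rightarrow> real) \<Rightarrow> bool" where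
  "geod_convex_fun M d f \<longleftrightarrow>
     (\<forall>\<gamma>. geodesic_curve M d \<gamma> \<longrightarrow>
        (\<forall>t\<in>{0..1}. f (\<gamma> t) \<le> (1 - t) * f (\<gamma> 0) + t * f (\<gamma> 1)))"

text \<open>Not the library's \<open>local_lipschitz\<close>: here the function is Lipschitz on every ball of finite radius.\<close>

definition lipschitz_on_balls :: "('a::metric_space \<Rightarrow> real) \<Rightarrow> bool" where
  "lipschitz_on_balls f \<longleftrightarrow> (\<forall>x r. \<exists>L. L-lipschitz_on (ball x r) f)"

text \<open>
  Points of the \<open>n\<close>-fold product are the functions in \<open>{..<n} \<rightarrow>\<^sub>E UNIV\<close>.  Since the base space will be
  second countable, the product sigma-algebra below is the Borel sigma-algebra of \<open>dist2 n\<close>.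
\<close>

definition dist2 :: "nat \<Rightarrow> (nat \<Rightarrow> 'a::metric_space) \<Rightarrow> (nat \<Rightarrow> 'a) \<Rightarrow> real" where
  "dist2 n x y = sqrt (\<Sum>i<n. (dist (x i) (y i))\<^sup>2)"

text \<open>The real infimum is only meaningful for \<open>A \<noteq> {}\<close>; below, \<open>A\<close> always has measure at least \<open>1/2\<close>.\<close>

definition enlargement2 :: "nat \<Rightarrow> (nat \<Rightarrow> 'a::metric_space) set \<Rightarrow> real \<Rightarrow> (nat \<Rightarrow> 'a) set" where
  "enlargement2 n A r = {x \<in> {..<n} \<rightarrow>\<^sub>E UNIV. (INF y\<in>A. dist2 n x y) \<le> r}"

definition CCI2_inf :: "'a::metric_space measure \<Rightarrow> (real \<Rightarrow> real) \<Rightarrow> bool" where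
  "CCI2_inf \<mu> \<alpha> \<longleftrightarrow>
     (\<forall>n\<ge>1. \<forall>A \<in> sets (Pi\<^sub>M {..<n} (\<lambda>_. borel)).
        geod_convex_set ({..<n} \<rightarrow>\<^sub>E UNIV) (dist2 n) A \<longrightarrow>
        measure (Pi\<^sub>M {..<n} (\<lambda>_. \<mu>)) A \<ge> 1 / 2 \<longrightarrow>
        (\<forall>r\<ge>0. measure (Pi\<^sub>M {..<n} (\<lambda>_. \<mu>)) (enlargement2 n A r) \<ge> 1 - \<alpha> r))"

definition descending_slope :: "('a::metric_space \<Rightarrow> real) \<Rightarrow> 'a \<Rightarrow> ennreal" where
  "descending_slope f x =
     (if x islimpt UNIV
      then Limsup (at x) (\<lambda>y. ennreal (max (- (f y - f x)) 0 / dist y x))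
      else 0)"

definition gauss_tail :: "real \<Rightarrow> real" where
  "gauss_tail x = 1 / sqrt (2 * pi) * (LINT u:{x..}|lborel. exp (- u\<^sup>2 / 2))"

text \<open>Meaningful for \<open>0 \<le> p < 1\<close>, as \<open>gauss_tail\<close> is a decreasing bijection from the reals onto \<open>(0,1)\<close>.\<close>

definition gauss_tail_inv :: "real \<Rightarrow> ereal" where
  "gauss_tail_inv p = (if p = 0 then \<infinity> else ereal (inv gauss_tail p))"

text \<open>
  For \<open>0 \<le> p \<le> 1/2\<close> the inverse is nonnegative, so \<open>e2ennreal\<close> truncates nothing.  Working in
  \<open>ennreal\<close> makes the supremum of the empty set \<open>0\<close> and \<open>\<infinity> * 0 = 0\<close>.
\<close>

definition sqrt_poincare_const :: "(real \<Rightarrow> real) \<Rightarrow> ennreal" where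
  "sqrt_poincare_const \<alpha> =
     Sup {e2ennreal (gauss_tail_inv (\<alpha> r) / ereal r) | r. r > 0 \<and> \<alpha> r \<le> 1 / 2}"

definition poincare_const :: "(real \<Rightarrow> real) \<Rightarrow> ennreal" where
  "poincare_const \<alpha> = (sqrt_poincare_const \<alpha>)\<^sup>2"

text \<open>
  The Bochner integral is \<open>0\<close> for non-integrable functions, so both integrability conditions are
  needed to express \<open>f \<in> L\<^sup>2\<close>.
\<close>

definition finite_variance :: "'a measure \<Rightarrow> ('a \<Rightarrow> real) \<Rightarrow> bool" where
  "finite_variance \<mu> f \<longleftrightarrow>
     integrable \<mu> f \<and> integrable \<mu> (\<lambda>x. (f x - prob_space.expectation \<mu> f)\<^sup>2)"

end

theory Submission
  imports Defs
begin

text \<open>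
  Write \<open>g\<close> for the descending slope of a convex function \<open>f\<close>. Along a geodesic from \<open>x\<close> to \<open>y\<close>
  the difference quotients of \<open>f\<close> at \<open>x\<close> are monotone, so \<open>g x\<close>, although defined by a limit at \<open>x\<close>,
  controls \<open>f\<close> globally: \<open>f x - f y \<le> g x * dist x y\<close> for all \<open>y\<close> (\<open>descending_slope_supports\<close>).

  The concentration property is applied only to sets \<open>A\<close> of points with
  \<open>f x\<^sub>1 + \<dots> + f x\<^sub>n \<le> c\<close>. They are convex because a geodesic of the product has
  geodesic components (\<open>geodesic_curve_component\<close>). Adding up the slope inequality over the coordinates
  and using Cauchy-Schwarz, every point of the \<open>r\<close>-enlargement of \<open>A\<close> satisfies
  \<open>f x\<^sub>1 + \<dots> + f x\<^sub>n \<le> c + r * sqrt ((g x\<^sub>1)\<^sup>2 + \<dots> + (g x\<^sub>n)\<^sup>2)\<close>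
  (\<open>sum_le_on_enlargement\<close>). Let \<open>m\<close> and \<open>\<sigma>\<^sup>2\<close> be the mean and the variance of \<open>f\<close>, take
  \<open>c = n m + \<epsilon> \<sigma> sqrt n\<close> with a small \<open>\<epsilon> > 0\<close>, and let \<open>n\<close> tend to infinity.
  By the central limit theorem \<open>A\<close> eventually has measure at least \<open>1/2\<close>. By the law of large numbers the
  square root is about \<open>sqrt (n I)\<close>, where \<open>I\<close> is the integral of \<open>g\<^sup>2\<close>. So the
  enlargement is essentially contained in the set where the normalised sum is at most \<open>r * sqrt I / \<sigma>\<close>, and the
  central limit theorem gives \<open>gauss_tail (r * sqrt I / \<sigma>) \<le> \<alpha> r\<close>
  (\<open>gauss_tail_le_of_concentration\<close>). Applying the decreasing inverse of \<open>gauss_tail\<close> and taking the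
  supremum over \<open>r\<close> is the Poincare inequality (\<open>convex_poincare_inequality\<close>).

  For the second part, the case \<open>n = 1\<close> of the same argument bounds the upper tail of a Lipschitz \<open>f\<close> by
  \<open>\<alpha>\<close>, so the positive part of \<open>f\<close> is square integrable. The lower tail is out of reach in this way, since
  superlevel sets are not convex. But the truncations \<open>max f (- k)\<close> are convex, Lipschitz and square
  integrable, and their slopes are bounded by the Lipschitz constant; the inequality just proved therefore bounds
  their variances uniformly in \<open>k\<close>, the constant being positive because \<open>\<alpha>\<close> takes arbitrarily small values. Letting
  \<open>k\<close> tend to infinity, Fatou's lemma gives \<open>f \<in> L\<^sup>2\<close> (\<open>finite_variance_of_lipschitz\<close>).
\<close>

section \<open>Geodesics and convexity in products\<close>

lemma sum_mult_le_L2_set: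
  fixes f g :: "'i \<Rightarrow> real"
  shows "(\<Sum>i\<in>A. f i * g i) \<le> L2_set f A * L2_set g A"
  by (rule order_trans[OF sum_mono L2_set_mult_ineq]) (simp add: abs_mult[symmetric])

lemma dist2_eq_L2_set: "dist2 n x y = L2_set (\<lambda>i. dist (x i) (y i)) {..<n}"
  by (simp add: dist2_def L2_set_def)

text \<open>
  This is the equality case of Minkowski's inequality. Fix \<open>0 \<le> s \<le> t \<le> 1\<close>, let \<open>e\<close> be the vector of
  coordinate distances between the end points and \<open>a\<close>, \<open>b\<close>, \<open>c\<close> those over the parameter intervals
  \<open>[0,s]\<close>, \<open>[s,t]\<close>, \<open>[t,1]\<close>. The triangle inequality \<open>e \<le> a + b + c\<close>, paired with \<open>e\<close>, and
  Cauchy-Schwarz for \<open>a\<close> and \<open>c\<close> force the inner product of \<open>b\<close> and \<open>e\<close> to be so large that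
  \<open>b - (t - s) * e\<close> has norm \<open>0\<close>.
\<close>

lemma geodesic_curve_component:
  fixes \<gamma> :: "real \<Rightarrow> nat \<Rightarrow> 'a::metric_space"
  assumes \<gamma>: "geodesic_curve ({..<n} \<rightarrow>\<^sub>E UNIV) (dist2 n) \<gamma>" and i: "i < n"
  shows "geodesic_curve UNIV dist (\<lambda>t. \<gamma> t i)"
proof -
  have main: "dist (\<gamma> s i) (\<gamma> t i) = (t - s) * dist (\<gamma> 0 i) (\<gamma> 1 i)"
    if st: "0 \<le> s" "s \<le> t" "t \<le> 1" for s t
  proof -
    define a b c e where "a = (\<lambda>i. dist (\<gamma> 0 i) (\<gamma> s i))" and "b = (\<lambda>i. dist (\<gamma> s i) (\<gamma> t i))"
      and "c = (\<lambda>i. dist (\<gamma> t i) (\<gamma> 1 i))" and "e = (\<lambda>i. dist (\<gamma> 0 i) (\<gamma> 1 i))"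
    define D where "D = L2_set e {..<n}"
    have speed: "dist2 n (\<gamma> u) (\<gamma> v) = \<bar>v - u\<bar> * dist2 n (\<gamma> 0) (\<gamma> 1)"
      if "u \<in> {0..1}" "v \<in> {0..1}" for u v
      using \<gamma> that unfolding geodesic_curve_def by blast
    have La: "L2_set a {..<n} = s * D" and Lb: "L2_set b {..<n} = (t - s) * D"
      and Lc: "L2_set c {..<n} = (1 - t) * D"
      using speed[of 0 s] speed[of s t] speed[of t 1] st
      by (simp_all add: dist2_eq_L2_set a_def b_def c_def e_def D_def)
    have sq: "(\<Sum>j<n. (e j)\<^sup>2) = D\<^sup>2" "(\<Sum>j<n. (b j)\<^sup>2) = ((t - s) * D)\<^sup>2"
      by (simp_all add: Lb[symmetric]) (simp_all add: D_def L2_set_def sum_nonneg)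
    have "D\<^sup>2 = (\<Sum>j<n. e j * e j)"
      unfolding sq(1)[symmetric] by (simp add: power2_eq_square)
    also have "\<dots> \<le> (\<Sum>j<n. (a j + b j + c j) * e j)"
    proof (intro sum_mono mult_right_mono)
      show "e j \<le> a j + b j + c j" for j
        unfolding a_def b_def c_def e_def by metric
    qed (simp add: e_def)
    also have "\<dots> = (\<Sum>j<n. a j * e j) + (\<Sum>j<n. b j * e j) + (\<Sum>j<n. c j * e j)"
      by (simp add: distrib_right sum.distrib)
    also have "\<dots> \<le> s * D * D + (\<Sum>j<n. b j * e j) + (1 - t) * D * D"
      using sum_mult_le_L2_set[of a e "{..<n}"] sum_mult_le_L2_set[of c e "{..<n}"]
      by (simp add: La Lc D_def[symmetric])
    finally have be: "(t - s) * D\<^sup>2 \<le> (\<Sum>j<n. b j * e j)"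
      by (simp add: algebra_simps power2_eq_square)
    have "(\<Sum>j<n. (b j - q * e j)\<^sup>2)
        = (\<Sum>j<n. (b j)\<^sup>2) - 2 * q * (\<Sum>j<n. b j * e j) + q\<^sup>2 * (\<Sum>j<n. (e j)\<^sup>2)" for q
      by (simp add: power2_diff sum.distrib sum_subtractf sum_distrib_left power_mult_distrib mult_ac)
    then have "(\<Sum>j<n. (b j - (t - s) * e j)\<^sup>2)
        = (\<Sum>j<n. (b j)\<^sup>2) - 2 * (t - s) * (\<Sum>j<n. b j * e j) + (t - s)\<^sup>2 * (\<Sum>j<n. (e j)\<^sup>2)" .
    also have "\<dots> \<le> ((t - s) * D)\<^sup>2 - 2 * (t - s) * ((t - s) * D\<^sup>2) + (t - s)\<^sup>2 * D\<^sup>2"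
      unfolding sq using mult_left_mono[OF be, of "2 * (t - s)"] st by simp
    also have "\<dots> = 0"
      by (simp add: power2_eq_square algebra_simps)
    finally have "(\<Sum>j<n. (b j - (t - s) * e j)\<^sup>2) = 0"
      by (intro antisym sum_nonneg) auto
    then have "(b i - (t - s) * e i)\<^sup>2 = 0"
      using i by (subst (asm) sum_nonneg_eq_0_iff) auto
    then show ?thesis
      by (simp add: b_def e_def)
  qed
  show ?thesis
    unfolding geodesic_curve_def
  proof (intro conjI ballI)
    fix s t :: real assume "s \<in> {0..1}" "t \<in> {0..1}"
    then show "dist (\<gamma> s i) (\<gamma> t i) = \<bar>t - s\<bar> * dist (\<gamma> 0 i) (\<gamma> 1 i)"
      using main[of s t] main[of t s] by (cases "s \<le> t") (auto simp: dist_commute)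
  qed simp
qed

lemma geod_convex_set_sum_sublevel:
  assumes f: "geod_convex_fun UNIV dist f"
  shows "geod_convex_set ({..<n} \<rightarrow>\<^sub>E UNIV) (dist2 n) {x \<in> {..<n} \<rightarrow>\<^sub>E UNIV. (\<Sum>i<n. f (x i)) \<le> c}"
  unfolding geod_convex_set_def
proof (intro conjI allI impI ballI)
  fix \<gamma> and t :: real
  assume H: "geodesic_curve ({..<n} \<rightarrow>\<^sub>E UNIV) (dist2 n) \<gamma> \<and>
    \<gamma> 0 \<in> {x \<in> {..<n} \<rightarrow>\<^sub>E UNIV. (\<Sum>i<n. f (x i)) \<le> c} \<and>
    \<gamma> 1 \<in> {x \<in> {..<n} \<rightarrow>\<^sub>E UNIV. (\<Sum>i<n. f (x i)) \<le> c}" and t: "t \<in> {0..1}"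
  have "(\<Sum>i<n. f (\<gamma> t i)) \<le> (\<Sum>i<n. (1 - t) * f (\<gamma> 0 i) + t * f (\<gamma> 1 i))"
    using geodesic_curve_component[of n \<gamma>] H t f unfolding geod_convex_fun_def
    by (intro sum_mono) (auto simp: Ball_def)
  also have "\<dots> = (1 - t) * (\<Sum>i<n. f (\<gamma> 0 i)) + t * (\<Sum>i<n. f (\<gamma> 1 i))"
    by (simp add: sum.distrib sum_distrib_left)
  also have "\<dots> \<le> (1 - t) * c + t * c"
    using H t by (intro add_mono mult_left_mono) auto
  finally have "(\<Sum>i<n. f (\<gamma> t i)) \<le> c"
    by (simp add: algebra_simps)
  then show "\<gamma> t \<in> {x \<in> {..<n} \<rightarrow>\<^sub>E UNIV. (\<Sum>i<n. f (x i)) \<le> c}"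
    using H t by (auto simp: geodesic_curve_def)
qed auto

section \<open>The descending slope of a convex function\<close>

lemma lipschitz_on_balls_imp_continuous:
  assumes "lipschitz_on_balls f"
  shows "continuous_on UNIV f"
proof -
  have "isCont f x" for x
  proof -
    obtain L where "L-lipschitz_on (ball x 1) f"
      using assms unfolding lipschitz_on_balls_def by blast
    then have "continuous (at x within ball x 1) f"
      by (rule lipschitz_on_continuous_within) simp
    then show ?thesis
      by (subst (asm) at_within_open) auto
  qed
  then show ?thesis
    by (simp add: continuous_on_eq_continuous_at)
qed

text \<open>
  Convexity along a geodesic from \<open>x\<close> to \<open>y\<close> says that the points of the geodesic close to \<open>x\<close> have a
  difference quotient at least as large as \<open>y\<close>, so every quotient is already seen in the limit at \<open>x\<close>. For
  \<open>y = x\<close> the quotient is \<open>0 / 0 = 0\<close> and does no harm.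
\<close>

lemma descending_slope_eq_SUP:
  fixes f :: "'a::metric_space \<Rightarrow> real"
  assumes geo: "geodesic_metric (UNIV :: 'a set) dist" and f: "geod_convex_fun UNIV dist f"
  shows "descending_slope f x = (SUP y. ennreal (max (f x - f y) 0 / dist y x))"
proof (rule antisym)
  have "Limsup (at x) (\<lambda>y. ennreal (max (- (f y - f x)) 0 / dist y x))
      \<le> (SUP y. ennreal (max (f x - f y) 0 / dist y x))"
    by (intro Limsup_bounded always_eventually allI) (rule SUP_upper2, auto)
  then show "descending_slope f x \<le> (SUP y. ennreal (max (f x - f y) 0 / dist y x))"
    by (simp add: descending_slope_def)
next
  show "(SUP y. ennreal (max (f x - f y) 0 / dist y x)) \<le> descending_slope f x"
  proof (rule SUP_least)
    fix y
    show "ennreal (max (f x - f y) 0 / dist y x) \<le> descending_slope f x"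
    proof (cases "y = x")
      case False
      obtain \<gamma> where \<gamma>: "geodesic_curve UNIV dist \<gamma>" "\<gamma> 0 = x" "\<gamma> 1 = y"
        using geo unfolding geodesic_metric_def by blast
      have dist_\<gamma>: "dist (\<gamma> t) x = t * dist y x" if "0 \<le> t" "t \<le> 1" for t
        using \<gamma> that unfolding geodesic_curve_def
        by (metis abs_of_nonneg atLeastAtMost_iff diff_zero dist_commute le_numeral_extra(3) zero_le_one)
      \<comment> \<open>Geodesics reach arbitrarily close to \<open>x\<close>; in particular \<open>x\<close> is not isolated.\<close>
      have near: "\<exists>t>0. t \<le> 1 \<and> t * dist y x < d" if "d > 0" for d
      proof (intro exI conjI)
        let ?t = "min 1 (d / (2 * dist y x))"
        show "0 < ?t" "?t \<le> 1"
          using False that by auto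
        have "?t * dist y x \<le> d / (2 * dist y x) * dist y x"
          by (intro mult_right_mono) auto
        also have "\<dots> < d"
          using False that by simp
        finally show "?t * dist y x < d" .
      qed
      have "x islimpt UNIV"
        unfolding islimpt_approachable
      proof (intro allI impI)
        fix d :: real assume "d > 0"
        then obtain t where t: "t > 0" "t \<le> 1" "t * dist y x < d"
          using near by blast
        then show "\<exists>x'\<in>UNIV. x' \<noteq> x \<and> dist x' x < d"
          using dist_\<gamma>[of t] False by (intro bexI[of _ "\<gamma> t"]) auto
      qed
      moreover have "ennreal (max (f x - f y) 0 / dist y x)
          \<le> Limsup (at x) (\<lambda>y. ennreal (max (- (f y - f x)) 0 / dist y x))"
        unfolding Limsup_def
      proof (rule INF_greatest)
        fix P assume "P \<in> {P. eventually P (at x)}"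
        then obtain d where d: "d > 0" "\<And>z. z \<noteq> x \<Longrightarrow> dist z x < d \<Longrightarrow> P z"
          unfolding eventually_at by auto
        then obtain t where t: "t > 0" "t \<le> 1" "t * dist y x < d"
          using near by blast
        have "\<gamma> t \<noteq> x"
          using dist_\<gamma>[of t] t False by auto
        then have "P (\<gamma> t)"
          using d(2)[of "\<gamma> t"] dist_\<gamma>[of t] t by auto
        have "f (\<gamma> t) \<le> (1 - t) * f x + t * f y"
          using f \<gamma> t unfolding geod_convex_fun_def by force
        then have "t * (f x - f y) \<le> f x - f (\<gamma> t)"
          by (simp add: algebra_simps)
        then have "t * max (f x - f y) 0 \<le> max (- (f (\<gamma> t) - f x)) 0"
          using t by (simp add: max_def mult_le_0_iff) (smt (verit) mult_pos_pos)
        then have "max (f x - f y) 0 / dist y x \<le> max (- (f (\<gamma> t) - f x)) 0 / dist (\<gamma> t) x"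
          using dist_\<gamma>[of t] t False by (simp add: divide_simps mult.commute)
        then show "ennreal (max (f x - f y) 0 / dist y x)
            \<le> Sup ((\<lambda>y. ennreal (max (- (f y - f x)) 0 / dist y x)) ` {x. P x})"
          using \<open>P (\<gamma> t)\<close> by (intro SUP_upper2[of "\<gamma> t"]) (auto intro: ennreal_leI)
      qed
      ultimately show ?thesis
        by (simp add: descending_slope_def)
    qed simp
  qed
qed

lemma descending_slope_le_lipschitz:
  assumes "L-lipschitz_on (ball x r) f" "r > 0"
  shows "descending_slope f x \<le> ennreal L"
proof -
  have "eventually (\<lambda>y. ennreal (max (- (f y - f x)) 0 / dist y x) \<le> ennreal L) (at x)"
    unfolding eventually_at
  proof (intro exI[of _ r] conjI ballI impI ennreal_leI)
    fix y assume y: "y \<noteq> x \<and> dist y x < r"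
    then have "\<bar>f y - f x\<bar> \<le> L * dist y x"
      using lipschitz_onD[OF assms(1), of y x] \<open>r > 0\<close> by (simp add: dist_real_def dist_commute)
    then show "max (- (f y - f x)) 0 / dist y x \<le> L"
      using y lipschitz_on_nonneg[OF assms(1)] by (auto simp: divide_simps)
  qed (use assms in auto)
  then show ?thesis
    by (auto simp: descending_slope_def intro: Limsup_bounded)
qed

lemma descending_slope_finite:
  assumes "lipschitz_on_balls f"
  shows "descending_slope f x < \<infinity>"
proof -
  obtain L where "L-lipschitz_on (ball x 1) f"
    using assms unfolding lipschitz_on_balls_def by blast
  from descending_slope_le_lipschitz[OF this] show ?thesis
    by (auto intro: le_less_trans)
qed

lemma descending_slope_supports:
  fixes f :: "'a::metric_space \<Rightarrow> real"
  assumes geo: "geodesic_metric (UNIV :: 'a set) dist" and f: "geod_convex_fun UNIV dist f"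
    and lip: "lipschitz_on_balls f"
  shows "f x - f y \<le> enn2real (descending_slope f x) * dist x y"
proof (cases "x = y")
  case False
  have fin: "descending_slope f x \<noteq> \<infinity>"
    using descending_slope_finite[OF lip, of x] by simp
  have "ennreal (max (f x - f y) 0 / dist y x) \<le> ennreal (enn2real (descending_slope f x))"
    using SUP_upper[of y UNIV "\<lambda>y. ennreal (max (f x - f y) 0 / dist y x)"] fin
      descending_slope_eq_SUP[OF geo f, of x]
    by (metis ennreal_enn2real_if infinity_ennreal_def UNIV_I)
  then have "max (f x - f y) 0 / dist y x \<le> enn2real (descending_slope f x)"
    by (subst (asm) ennreal_le_iff) auto
  then have "max (f x - f y) 0 \<le> enn2real (descending_slope f x) * dist y x"
    using False by (simp add: divide_simps)
  then show ?thesis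
    by (simp add: dist_commute)
qed simp

text \<open>
  Off the point \<open>y\<close> each difference quotient is continuous in \<open>x\<close>, and at \<open>y\<close> it vanishes; hence it is lower
  semicontinuous, and so is the slope as a supremum of these quotients. Measurability matters because the
  nonnegative integral of a non-measurable function would only be a lower integral.
\<close>

lemma descending_slope_measurable:
  fixes f :: "'a::metric_space \<Rightarrow> real"
  assumes geo: "geodesic_metric (UNIV :: 'a set) dist" and f: "geod_convex_fun UNIV dist f"
    and lip: "lipschitz_on_balls f"
  shows "descending_slope f \<in> borel_measurable borel"
proof (rule borel_measurableI_greater)
  fix c :: ennreal
  let ?q = "\<lambda>y x. ennreal (max (f x - f y) 0 / dist y x)"
  have "open (?q y -` {c<..} \<inter> - {y})" for y
  proof -
    have "continuous_on (- {y}) f"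
      using lipschitz_on_balls_imp_continuous[OF lip] by (rule continuous_on_subset) simp
    then have "continuous_on (- {y}) (?q y)"
      by (intro continuous_intros continuous_on_ennreal) auto
    then show ?thesis
      by (subst (asm) continuous_on_open_vimage) auto
  qed
  moreover have "{x. c < descending_slope f x} = (\<Union>y. ?q y -` {c<..} \<inter> - {y})"
    by (auto simp: descending_slope_eq_SUP[OF geo f] less_SUP_iff)
  ultimately show "{x \<in> space borel. c < descending_slope f x} \<in> sets borel"
    by (simp add: open_UN)
qed

text \<open>
  Cauchy-Schwarz turns the coordinatewise slope bounds into a bound in terms of the product distance, valid
  for every point of \<open>A\<close> and hence for the infimum over \<open>A\<close>.
\<close>

lemma sum_le_on_enlargement:
  fixes f g :: "'a::metric_space \<Rightarrow> real"
  assumes fg: "\<And>x y. f x - f y \<le> g x * dist x y" and A: "A \<noteq> {}" "\<And>y. y \<in> A \<Longrightarrow> (\<Sum>i<n. f (y i)) \<le> c"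
    and x: "x \<in> enlargement2 n A r"
  shows "(\<Sum>i<n. f (x i)) \<le> c + r * sqrt (\<Sum>i<n. (g (x i))\<^sup>2)"
proof -
  define H where "H = L2_set (\<lambda>i. g (x i)) {..<n}"
  have *: "(\<Sum>i<n. f (x i)) - c \<le> H * dist2 n x y" if "y \<in> A" for y
  proof -
    have "(\<Sum>i<n. f (x i)) - c \<le> (\<Sum>i<n. f (x i) - f (y i))"
      using A(2)[OF that] by (simp add: sum_subtractf)
    also have "\<dots> \<le> (\<Sum>i<n. g (x i) * dist (x i) (y i))"
      by (intro sum_mono fg)
    also have "\<dots> \<le> H * dist2 n x y"
      unfolding H_def dist2_eq_L2_set by (rule sum_mult_le_L2_set)
    finally show ?thesis .
  qed
  have "(\<Sum>i<n. f (x i)) - c \<le> H * r"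
  proof (cases "H = 0")
    case True
    then show ?thesis
      using * A(1) by auto
  next
    case False
    then have "H > 0"
      by (simp add: H_def less_le L2_set_nonneg)
    have "((\<Sum>i<n. f (x i)) - c) / H \<le> (INF y\<in>A. dist2 n x y)"
      using A(1) * \<open>H > 0\<close> by (intro cINF_greatest) (auto simp: divide_simps mult.commute)
    also have "\<dots> \<le> r"
      using x by (simp add: enlargement2_def)
    finally show ?thesis
      using \<open>H > 0\<close> by (simp add: divide_simps mult.commute)
  qed
  then show ?thesis
    by (simp add: H_def L2_set_def mult.commute)
qed

section \<open>The Gaussian tail\<close>

interpretation std_normal: real_distribution std_normal_distribution
  by (rule real_dist_normal_dist)

lemma isCont_cdf_std_normal: "isCont (cdf std_normal_distribution) x"
proof -
  have "emeasure std_normal_distribution {x} = 0"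
    by (subst emeasure_density) (auto simp: nn_integral_0_iff_AE intro!: AE_I'[of "{x}"] )
  then show ?thesis
    by (simp add: std_normal.isCont_cdf measure_def)
qed

lemma gauss_tail_eq_cdf: "gauss_tail x = 1 - cdf std_normal_distribution x"
proof -
  have "gauss_tail x = (LINT u|lborel. std_normal_density u * indicator {x..} u)"
    unfolding gauss_tail_def set_lebesgue_integral_def std_normal_density_def
    by (subst integral_mult_right_zero[symmetric]) (simp add: mult_ac)
  also have "\<dots> = (LINT u|std_normal_distribution. indicator {x..} u)"
    by (subst integral_density) auto
  also have "\<dots> = measure std_normal_distribution {x..}"
    by simp
  also have "\<dots> = measure std_normal_distribution {x<..}"
  proof -
    have "measure std_normal_distribution {x} = 0"
      using isCont_cdf_std_normal std_normal.isCont_cdf by blast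
    moreover have "{x..} = {x} \<union> {x<..}"
      by auto
    ultimately show ?thesis
      by (simp only:) (subst std_normal.finite_measure_Union, auto)
  qed
  also have "{x<..} = space std_normal_distribution - {..x}"
    by auto
  also have "measure std_normal_distribution \<dots> = 1 - cdf std_normal_distribution x"
    by (subst std_normal.prob_compl) (auto simp: cdf_def)
  finally show ?thesis .
qed

lemma cdf_std_normal_strict_mono:
  assumes "x < y"
  shows "cdf std_normal_distribution x < cdf std_normal_distribution y"
proof -
  have "emeasure std_normal_distribution {x<..y} \<noteq> 0"
  proof
    assume "emeasure std_normal_distribution {x<..y} = 0"
    moreover have "std_normal_density u \<noteq> 0" for u
      using normal_density_pos[of 1 0 u] by simp
    ultimately have "AE u in lborel. u \<notin> {x<..y}"
      by (subst (asm) emeasure_density)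
         (auto simp: nn_integral_0_iff_AE indicator_def less_le split: if_splits)
    then have "emeasure lborel {x<..y} = 0"
      by (subst (asm) AE_iff_measurable[of "{x<..y}"]) auto
    with assms show False
      by simp
  qed
  then have "measure std_normal_distribution {x<..y} > 0"
    using std_normal.emeasure_eq_measure[of "{x<..y}"] by (simp add: zero_less_measure_iff)
  then show ?thesis
    using std_normal.cdf_diff_eq[OF assms] by linarith
qed

lemma cdf_std_normal_0: "cdf std_normal_distribution 0 = 1 / 2"
proof -
  have "gauss_tail 0 = cdf std_normal_distribution 0"
  proof -
    have "cdf std_normal_distribution 0 = (LINT u|std_normal_distribution. indicator {..0} u)"
      by (simp add: cdf_def)
    also have "\<dots> = (LINT u|lborel. std_normal_density u * indicator {..0} u)"
      by (subst integral_density) auto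
    also have "\<dots> = (LINT u|lborel. std_normal_density (- u) * indicator {..0} (- u))"
      using lborel_integral_real_affine[of "-1" "\<lambda>u. std_normal_density u * indicator {..0} u" 0] by simp
    also have "\<dots> = gauss_tail 0"
      unfolding gauss_tail_def set_lebesgue_integral_def std_normal_density_def
      by (subst integral_mult_right_zero[symmetric]) (intro Bochner_Integration.integral_cong, auto simp: indicator_def)
    finally show ?thesis ..
  qed
  then show ?thesis
    using gauss_tail_eq_cdf[of 0] by simp
qed

lemma gauss_tail_pos: "gauss_tail x > 0"
  using cdf_std_normal_strict_mono[of x "x + 1"] std_normal.cdf_bounded_prob[of "x + 1"]
  by (simp add: gauss_tail_eq_cdf)

lemma gauss_tail_less_iff: "gauss_tail x < gauss_tail y \<longleftrightarrow> y < x"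
  using cdf_std_normal_strict_mono[of x y] cdf_std_normal_strict_mono[of y x]
  by (cases x y rule: linorder_cases) (auto simp: gauss_tail_eq_cdf)

text \<open>
  The cumulative distribution function is continuous with limits \<open>0\<close> and \<open>1\<close>, so every value in \<open>(0,1)\<close> is
  attained; only for such values is \<open>inv\<close> an inverse.
\<close>

lemma gauss_tail_inv_into:
  assumes "0 < p" "p < 1"
  shows "gauss_tail (inv gauss_tail p) = p"
proof -
  have "\<exists>a. cdf std_normal_distribution a < 1 - p"
    using order_tendstoD(2)[OF std_normal.cdf_lim_at_bot, of "1 - p"] assms
    by (auto simp: eventually_at_bot_linorder)
  moreover have "\<exists>b. 1 - p < cdf std_normal_distribution b"
    using order_tendstoD(1)[OF std_normal.cdf_lim_at_top_prob, of "1 - p"] assms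
    by (auto simp: eventually_at_top_linorder)
  ultimately obtain a b where ab: "cdf std_normal_distribution a < 1 - p" "1 - p < cdf std_normal_distribution b"
    by blast
  then have "a \<le> b"
    using std_normal.cdf_nondecreasing[of b a] by linarith
  then obtain x where "cdf std_normal_distribution x = 1 - p"
    using IVT[of "cdf std_normal_distribution" a "1 - p" b] ab isCont_cdf_std_normal by auto
  then have "p \<in> range gauss_tail"
    by (auto simp: gauss_tail_eq_cdf intro!: image_eqI[of _ _ x])
  then show ?thesis
    by (rule f_inv_into_f)
qed

section \<open>Limit theorems for independent copies\<close>

context prob_space
begin

lemma
  assumes [measurable]: "Y \<in> borel_measurable M"
  shows distr_coordinate: "distr (Pi\<^sub>M UNIV (\<lambda>_::nat. M)) borel (\<lambda>\<omega>. Y (\<omega> i) :: real) = distr M borel Y"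
    and indep_vars_coordinates:
      "prob_space.indep_vars (Pi\<^sub>M UNIV (\<lambda>_::nat. M)) (\<lambda>_. borel) (\<lambda>i \<omega>. Y (\<omega> i)) UNIV"
proof -
  let ?P = "Pi\<^sub>M UNIV (\<lambda>_::nat. M)"
  interpret P: prob_space ?P
    by (intro prob_space_PiM prob_space_axioms)
  have component: "distr ?P M (\<lambda>\<omega>. \<omega> j) = M" for j
    using distr_PiM_component[of UNIV "\<lambda>_::nat. M" j] prob_space_axioms by simp
  have "distr ?P borel (\<lambda>\<omega>. Y (\<omega> i)) = distr (distr ?P M (\<lambda>\<omega>. \<omega> i)) borel Y"
    by (subst distr_distr) (auto simp: comp_def)
  then show "distr ?P borel (\<lambda>\<omega>. Y (\<omega> i)) = distr M borel Y"
    by (simp add: component)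
  have "P.indep_vars (\<lambda>_. M) (\<lambda>i \<omega>. \<omega> i) UNIV"
    by (subst P.indep_vars_iff_distr_eq_PiM') (simp_all add: component restrict_UNIV)
  then show "P.indep_vars (\<lambda>_. borel) (\<lambda>i \<omega>. Y (\<omega> i)) UNIV"
    by (rule P.indep_vars_compose2) simp
qed

lemma
  assumes [measurable]: "Y \<in> borel_measurable M"
  shows integral_coordinate: "(\<integral>\<omega>. Y (\<omega> i) \<partial>Pi\<^sub>M UNIV (\<lambda>_::nat. M)) = expectation (Y :: 'a \<Rightarrow> real)"
    and integrable_coordinate: "integrable (Pi\<^sub>M UNIV (\<lambda>_::nat. M)) (\<lambda>\<omega>. Y (\<omega> i)) \<longleftrightarrow> integrable M Y"
proof -
  let ?P = "Pi\<^sub>M UNIV (\<lambda>_::nat. M)"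
  have "(\<integral>\<omega>. Y (\<omega> i) \<partial>?P) = (\<integral>y. y \<partial>distr ?P borel (\<lambda>\<omega>. Y (\<omega> i)))"
    by (subst integral_distr) auto
  then show "(\<integral>\<omega>. Y (\<omega> i) \<partial>?P) = expectation Y"
    by (simp add: distr_coordinate integral_distr)
  have "integrable ?P (\<lambda>\<omega>. Y (\<omega> i)) \<longleftrightarrow> integrable (distr ?P borel (\<lambda>\<omega>. Y (\<omega> i))) (\<lambda>y. y)"
    by (subst integrable_distr_eq) auto
  then show "integrable ?P (\<lambda>\<omega>. Y (\<omega> i)) \<longleftrightarrow> integrable M Y"
    by (simp add: distr_coordinate integrable_distr_eq)
qed

lemma measure_PiM_lessThan:
  assumes "A \<in> sets (Pi\<^sub>M {..<n} (\<lambda>_. M))"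
  shows "measure (Pi\<^sub>M {..<n} (\<lambda>_. M)) A =
    measure (Pi\<^sub>M UNIV (\<lambda>_::nat. M)) {\<omega> \<in> space (Pi\<^sub>M UNIV (\<lambda>_::nat. M)). restrict \<omega> {..<n} \<in> A}"
proof -
  interpret P: product_prob_space "\<lambda>_::nat. M" UNIV
    by unfold_locales
  have "Pi\<^sub>M {..<n} (\<lambda>_. M) = distr (Pi\<^sub>M UNIV (\<lambda>_::nat. M)) (Pi\<^sub>M {..<n} (\<lambda>_. M)) (\<lambda>\<omega>. restrict \<omega> {..<n})"
    by (rule P.distr_PiM_restrict_finite[symmetric]) auto
  then have "measure (Pi\<^sub>M {..<n} (\<lambda>_. M)) A =
      measure (distr (Pi\<^sub>M UNIV (\<lambda>_::nat. M)) (Pi\<^sub>M {..<n} (\<lambda>_. M)) (\<lambda>\<omega>. restrict \<omega> {..<n})) A"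
    by simp
  also have "\<dots> = measure (Pi\<^sub>M UNIV (\<lambda>_::nat. M))
      ((\<lambda>\<omega>. restrict \<omega> {..<n}) -` A \<inter> space (Pi\<^sub>M UNIV (\<lambda>_::nat. M)))"
    using assms by (intro measure_distr measurable_restrict_subset) auto
  also have "(\<lambda>\<omega>. restrict \<omega> {..<n}) -` A \<inter> space (Pi\<^sub>M UNIV (\<lambda>_::nat. M)) =
      {\<omega> \<in> space (Pi\<^sub>M UNIV (\<lambda>_::nat. M)). restrict \<omega> {..<n} \<in> A}"
    by auto
  finally show ?thesis .
qed

text \<open>
  The squared slope has no second moment in general, so Chebyshev's inequality is not available. Instead, truncate \<open>h\<close> at
  a level \<open>k\<close> whose excess has small mean. Hoeffding's inequality handles the sum of the truncated
  variables and Markov's inequality the sum of the excesses.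
\<close>

lemma weak_law_upper:
  assumes h: "integrable M h" "\<And>x. 0 \<le> h x" and \<delta>: "\<delta> > 0"
  shows "(\<lambda>n. measure (Pi\<^sub>M UNIV (\<lambda>_::nat. M))
    {\<omega> \<in> space (Pi\<^sub>M UNIV (\<lambda>_::nat. M)). (\<Sum>i<n. h (\<omega> i)) > real n * (expectation h + \<delta>)}) \<longlonglongrightarrow> 0"
proof (rule LIMSEQ_I)
  fix e :: real assume e: "e > 0"
  let ?P = "Pi\<^sub>M UNIV (\<lambda>_::nat. M)"
  interpret P: prob_space ?P
    by (intro prob_space_PiM prob_space_axioms)
  have [measurable]: "h \<in> borel_measurable M"
    using h by auto
  have "(\<lambda>k. expectation (\<lambda>x. min (h x) (real k))) \<longlonglongrightarrow> expectation h"
  proof (rule integral_dominated_convergence[where w=h])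
    show "AE x in M. (\<lambda>k. min (h x) (real k)) \<longlonglongrightarrow> h x"
    proof (rule AE_I2, rule tendsto_eventually)
      fix x
      show "\<forall>\<^sub>F k in sequentially. min (h x) (real k) = h x"
        using eventually_ge_at_top[of "nat \<lceil>h x\<rceil>"] by eventually_elim linarith
    qed
  qed (use h in auto)
  then have "\<forall>\<^sub>F k in sequentially. expectation h - e * \<delta> / 4 < expectation (\<lambda>x. min (h x) (real k)) \<and> k > 0"
    using e \<delta> by (intro eventually_conj order_tendstoD(1)[where y="expectation h"] eventually_gt_at_top) auto
  then obtain k :: nat where k: "expectation h - e * \<delta> / 4 < expectation (\<lambda>x. min (h x) (real k))" "k > 0"
    by (auto simp: eventually_at_top_linorder)
  define l u where "l = (\<lambda>x. min (h x) (real k))" and "u = (\<lambda>x. h x - l x)"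
  have [measurable]: "l \<in> borel_measurable M" "u \<in> borel_measurable M"
    by (auto simp: l_def u_def)
  have l: "integrable M l" "\<And>x. 0 \<le> l x" "\<And>x. l x \<le> k"
    using h by (auto simp: l_def intro!: Bochner_Integration.integrable_bound[OF h(1)])
  have u: "integrable M u" "\<And>x. 0 \<le> u x"
    using h l by (auto simp: u_def l_def)
  have Eu: "expectation u \<le> e * \<delta> / 4"
    using k h l by (simp add: u_def) (simp add: l_def)
  have El: "expectation l \<le> expectation h"
    using h l by (intro integral_mono) (auto simp: l_def)
  interpret H: Hoeffding_ineq_iid ?P "{..<n}" "\<lambda>i \<omega>. l (\<omega> i)" "\<lambda>\<omega>. l (\<omega> 0)" 0 "real k"
      "P.expectation (\<lambda>\<omega>. l (\<omega> 0))" for n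
  proof unfold_locales
    show "P.indep_vars (\<lambda>_. borel) (\<lambda>i \<omega>. l (\<omega> i)) {..<n}"
      by (rule P.indep_vars_subset[OF indep_vars_coordinates]) auto
  qed (use l in \<open>auto simp: distr_coordinate\<close>)
  have bounded: "P.prob {\<omega> \<in> space ?P. (\<Sum>i<n. l (\<omega> i)) \<ge> real n * expectation l + real n * (\<delta> / 2)}
      \<le> exp (- (\<delta>\<^sup>2 / (2 * (real k)\<^sup>2)) * real n)" if "n > 0" for n
  proof -
    have *: "- 2 * (real n * (\<delta> / 2))\<^sup>2 / (real n * (real k - 0)\<^sup>2) = - (\<delta>\<^sup>2 / (2 * (real k)\<^sup>2)) * real n"
      using that k by (simp add: field_simps power2_eq_square)
    have **: "P.expectation (\<lambda>\<omega>. l (\<omega> 0)) = expectation l"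
      by (rule integral_coordinate) simp
    have "0 \<le> real n * (\<delta> / 2)" "0 < real k" "{..<n} \<noteq> {}"
      using that \<delta> k by auto
    from H.Hoeffding_ineq_ge[OF this] show ?thesis
      unfolding card_lessThan * ** .
  qed
  have tail: "P.prob {\<omega> \<in> space ?P. (\<Sum>i<n. u (\<omega> i)) \<ge> real n * (\<delta> / 2)} \<le> e / 2" if "n > 0" for n
  proof -
    have int: "integrable ?P (\<lambda>\<omega>. \<Sum>i<n. u (\<omega> i))"
      using u by (intro Bochner_Integration.integrable_sum) (simp add: integrable_coordinate)
    have "P.prob {\<omega> \<in> space ?P. (\<Sum>i<n. u (\<omega> i)) \<ge> real n * (\<delta> / 2)}
        \<le> P.expectation (\<lambda>\<omega>. \<Sum>i<n. u (\<omega> i)) / (real n * (\<delta> / 2))"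
      using int u \<delta> that by (intro integral_Markov_inequality_measure[where A="{}"]) (auto intro!: sum_nonneg)
    also have "P.expectation (\<lambda>\<omega>. \<Sum>i<n. u (\<omega> i)) = real n * expectation u"
      using u by (subst Bochner_Integration.integral_sum) (auto simp: integrable_coordinate integral_coordinate)
    also have "real n * expectation u / (real n * (\<delta> / 2)) \<le> e / 2"
      using Eu that \<delta> by (simp add: field_simps)
    finally show ?thesis .
  qed
  have "(\<lambda>n. exp (- (\<delta>\<^sup>2 / (2 * (real k)\<^sup>2)) * real n)) \<longlonglongrightarrow> 0"
  proof -
    have "filterlim (\<lambda>n. - (\<delta>\<^sup>2 / (2 * (real k)\<^sup>2)) * real n) at_bot sequentially"
      using \<delta> k by (intro filterlim_tendsto_neg_mult_at_bot[OF tendsto_const _ filterlim_real_sequentially]) auto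
    then show ?thesis
      by (rule filterlim_compose[OF exp_at_bot])
  qed
  then have "\<forall>\<^sub>F n in sequentially. exp (- (\<delta>\<^sup>2 / (2 * (real k)\<^sup>2)) * real n) < e / 2 \<and> n > 0"
    using e by (intro eventually_conj order_tendstoD(2)[where y=0] eventually_gt_at_top) auto
  then obtain N where N: "\<And>n. n \<ge> N \<Longrightarrow> exp (- (\<delta>\<^sup>2 / (2 * (real k)\<^sup>2)) * real n) < e / 2 \<and> n > 0"
    by (auto simp: eventually_at_top_linorder)
  show "\<exists>N. \<forall>n\<ge>N. norm (P.prob {\<omega> \<in> space ?P. (\<Sum>i<n. h (\<omega> i)) > real n * (expectation h + \<delta>)} - 0) < e"
  proof (intro exI allI impI)
    fix n assume "n \<ge> N"
    note n = N[OF this]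
    let ?L = "{\<omega> \<in> space ?P. (\<Sum>i<n. l (\<omega> i)) \<ge> real n * expectation l + real n * (\<delta> / 2)}"
    let ?U = "{\<omega> \<in> space ?P. (\<Sum>i<n. u (\<omega> i)) \<ge> real n * (\<delta> / 2)}"
    have meas: "?L \<in> sets ?P" "?U \<in> sets ?P"
      by measurable
    have "{\<omega> \<in> space ?P. (\<Sum>i<n. h (\<omega> i)) > real n * (expectation h + \<delta>)} \<subseteq> ?L \<union> ?U"
    proof
      fix \<omega> assume \<omega>: "\<omega> \<in> {\<omega> \<in> space ?P. (\<Sum>i<n. h (\<omega> i)) > real n * (expectation h + \<delta>)}"
      have "(\<Sum>i<n. h (\<omega> i)) = (\<Sum>i<n. l (\<omega> i)) + (\<Sum>i<n. u (\<omega> i))"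
        by (simp add: u_def sum.distrib[symmetric])
      moreover have "real n * expectation l \<le> real n * expectation h"
        using El by (simp add: mult_left_mono)
      ultimately show "\<omega> \<in> ?L \<union> ?U"
        using \<omega> by (auto simp: algebra_simps)
    qed
    then have "P.prob {\<omega> \<in> space ?P. (\<Sum>i<n. h (\<omega> i)) > real n * (expectation h + \<delta>)} \<le> P.prob (?L \<union> ?U)"
      using meas by (intro P.finite_measure_mono) auto
    also have "\<dots> \<le> P.prob ?L + P.prob ?U"
      by (rule measure_Un_le[OF meas])
    also have "\<dots> < e"
      using bounded[of n] tail[of n] n by linarith
    finally show "norm (P.prob {\<omega> \<in> space ?P. (\<Sum>i<n. h (\<omega> i)) > real n * (expectation h + \<delta>)} - 0) < e"
      by simp
  qed
qed

lemma central_limit_cdf: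
  assumes f: "integrable M f" "integrable M (\<lambda>x. (f x)\<^sup>2)" and var: "variance f = \<sigma>\<^sup>2" "\<sigma> > 0"
  shows "(\<lambda>n. measure (Pi\<^sub>M UNIV (\<lambda>_::nat. M)) {\<omega> \<in> space (Pi\<^sub>M UNIV (\<lambda>_::nat. M)).
      (\<Sum>i<n. f (\<omega> i)) \<le> real n * expectation f + \<sigma> * sqrt (real n) * t})
    \<longlonglongrightarrow> cdf std_normal_distribution t"
proof -
  let ?P = "Pi\<^sub>M UNIV (\<lambda>_::nat. M)"
  interpret P: prob_space ?P
    by (intro prob_space_PiM prob_space_axioms)
  have [measurable]: "f \<in> borel_measurable M"
    using f by auto
  let ?S = "\<lambda>n \<omega>. (\<Sum>i<n. f (\<omega> i) - expectation f) / sqrt (real n * \<sigma>\<^sup>2)"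
  have "weak_conv_m (\<lambda>n. distr ?P borel (?S n)) std_normal_distribution"
  proof (rule P.central_limit_theorem)
    show "P.variance (\<lambda>\<omega>. f (\<omega> n)) = \<sigma>\<^sup>2" for n
      using var integral_coordinate[of "\<lambda>x. (f x - expectation f)\<^sup>2" n]
      by (simp add: integral_coordinate)
    show "integrable ?P (\<lambda>\<omega>. (f (\<omega> n))\<^sup>2)" for n
      using f integrable_coordinate[of "\<lambda>x. (f x)\<^sup>2" n] by simp
  qed (use var in \<open>auto simp: integral_coordinate distr_coordinate indep_vars_coordinates\<close>)
  then have "(\<lambda>n. cdf (distr ?P borel (?S n)) t) \<longlonglongrightarrow> cdf std_normal_distribution t"
    using isCont_cdf_std_normal by (simp add: weak_conv_m_def weak_conv_def)
  moreover have "\<forall>\<^sub>F n in sequentially. cdf (distr ?P borel (?S n)) t =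
      P.prob {\<omega> \<in> space ?P. (\<Sum>i<n. f (\<omega> i)) \<le> real n * expectation f + \<sigma> * sqrt (real n) * t}"
    using eventually_gt_at_top[of 0]
  proof eventually_elim
    case (elim n)
    have "cdf (distr ?P borel (?S n)) t = P.prob (?S n -` {..t} \<inter> space ?P)"
      unfolding cdf_def by (subst measure_distr) auto
    also have "?S n -` {..t} \<inter> space ?P =
        {\<omega> \<in> space ?P. (\<Sum>i<n. f (\<omega> i)) \<le> real n * expectation f + \<sigma> * sqrt (real n) * t}"
      using elim var by (auto simp: real_sqrt_mult sum_subtractf divide_simps algebra_simps)
    finally show ?case .
  qed
  ultimately show ?thesis
    by (rule Lim_transform_eventually)
qed

text \<open>
  The passage to the limit in \<open>n\<close>. The assumption \<open>conc\<close> is what concentration says about the sublevel sets of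
  the sum; it is used at the level \<open>n m + \<epsilon> \<sigma> sqrt n\<close>, where the positive \<open>\<epsilon>\<close> makes the limiting Gaussian
  probability exceed \<open>1/2\<close> strictly. The same \<open>\<epsilon>\<close> is the slack in the law of large numbers, and it
  tends to \<open>0\<close> at the end.
\<close>

lemma gauss_tail_le_of_concentration:
  assumes f: "integrable M f" "integrable M (\<lambda>x. (f x)\<^sup>2)" and var: "variance f = \<sigma>\<^sup>2" "\<sigma> > 0"
    and g: "integrable M (\<lambda>x. (g x)\<^sup>2)" "g \<in> borel_measurable M" and r: "r \<ge> 0"
    and conc: "\<And>(n::nat) c. n \<ge> 1 \<Longrightarrow>
      1 / 2 \<le> measure (Pi\<^sub>M {..<n} (\<lambda>_. M)) {x \<in> space (Pi\<^sub>M {..<n} (\<lambda>_. M)). (\<Sum>i<n. f (x i)) \<le> c} \<Longrightarrow>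
      1 - a \<le> measure (Pi\<^sub>M {..<n} (\<lambda>_. M))
        {x \<in> space (Pi\<^sub>M {..<n} (\<lambda>_. M)). (\<Sum>i<n. f (x i)) \<le> c + r * sqrt (\<Sum>i<n. (g (x i))\<^sup>2)}"
  shows "gauss_tail (r * sqrt (expectation (\<lambda>x. (g x)\<^sup>2)) / \<sigma>) \<le> a"
proof -
  let ?P = "Pi\<^sub>M UNIV (\<lambda>_::nat. M)"
  interpret P: prob_space ?P
    by (intro prob_space_PiM prob_space_axioms)
  have [measurable]: "f \<in> borel_measurable M" "g \<in> borel_measurable M"
    using f g by auto
  define m I where "m = expectation f" and "I = expectation (\<lambda>x. (g x)\<^sup>2)"
  have concP: "1 - a \<le> P.prob {\<omega> \<in> space ?P. (\<Sum>i<n. f (\<omega> i)) \<le> c + r * sqrt (\<Sum>i<n. (g (\<omega> i))\<^sup>2)}"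
    if n: "n \<ge> 1" and half: "1 / 2 \<le> P.prob {\<omega> \<in> space ?P. (\<Sum>i<n. f (\<omega> i)) \<le> c}" for n c
  proof -
    let ?A = "{x \<in> space (Pi\<^sub>M {..<n} (\<lambda>_. M)). (\<Sum>i<n. f (x i)) \<le> c}"
    let ?B = "{x \<in> space (Pi\<^sub>M {..<n} (\<lambda>_. M)). (\<Sum>i<n. f (x i)) \<le> c + r * sqrt (\<Sum>i<n. (g (x i))\<^sup>2)}"
    have sp: "restrict \<omega> {..<n} \<in> space (Pi\<^sub>M {..<n} (\<lambda>_. M))" if "\<omega> \<in> space ?P" for \<omega>
      using that by (auto simp: space_PiM)
    have "?A \<in> sets (Pi\<^sub>M {..<n} (\<lambda>_. M))" "?B \<in> sets (Pi\<^sub>M {..<n} (\<lambda>_. M))"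
      by measurable
    from this[THEN measure_PiM_lessThan] show ?thesis
      using conc[OF n, of c] half sp by (simp cong: conj_cong)
  qed
  have step: "1 - a \<le> cdf std_normal_distribution (\<epsilon> + r * sqrt (I + \<epsilon>) / \<sigma>)" if \<epsilon>: "\<epsilon> > 0" for \<epsilon>
  proof -
    let ?t = "\<epsilon> + r * sqrt (I + \<epsilon>) / \<sigma>"
    let ?F = "\<lambda>n t. {\<omega> \<in> space ?P. (\<Sum>i<n. f (\<omega> i)) \<le> real n * m + \<sigma> * sqrt (real n) * t}"
    let ?G = "\<lambda>n. {\<omega> \<in> space ?P. (\<Sum>i<n. (g (\<omega> i))\<^sup>2) > real n * (I + \<epsilon>)}"
    have clt: "(\<lambda>n. P.prob (?F n t)) \<longlonglongrightarrow> cdf std_normal_distribution t" for t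
      unfolding m_def by (rule central_limit_cdf[OF f var])
    have "1 / 2 < cdf std_normal_distribution \<epsilon>"
      using cdf_std_normal_strict_mono[OF \<epsilon>] by (simp add: cdf_std_normal_0)
    from order_tendstoD(1)[OF clt this]
    have "\<forall>\<^sub>F n in sequentially. 1 / 2 < P.prob (?F n \<epsilon>)" .
    then have "\<forall>\<^sub>F n in sequentially. 1 - a \<le> P.prob (?F n ?t) + P.prob (?G n)"
      using eventually_ge_at_top[of 1]
    proof eventually_elim
      case (elim n)
      let ?B = "{\<omega> \<in> space ?P. (\<Sum>i<n. f (\<omega> i)) \<le> real n * m + \<sigma> * sqrt (real n) * \<epsilon> + r * sqrt (\<Sum>i<n. (g (\<omega> i))\<^sup>2)}"
      have meas: "?F n ?t \<in> sets ?P" "?G n \<in> sets ?P"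
        by measurable
      have "1 - a \<le> P.prob ?B"
        using elim by (intro concP) auto
      \<comment> \<open>Off \<open>?G n\<close> the square root is at most \<open>sqrt (n * (I + \<epsilon>))\<close>; in units of \<open>\<sigma> * sqrt n\<close> this accounts for the second term of \<open>?t\<close>.\<close>
      also have "?B \<subseteq> ?F n ?t \<union> ?G n"
      proof
        fix \<omega> assume \<omega>: "\<omega> \<in> ?B"
        show "\<omega> \<in> ?F n ?t \<union> ?G n"
        proof (cases "\<omega> \<in> ?G n")
          case False
          then have "sqrt (\<Sum>i<n. (g (\<omega> i))\<^sup>2) \<le> sqrt (real n) * sqrt (I + \<epsilon>)"
            using \<omega> by (auto simp: not_less simp flip: real_sqrt_mult)
          then have "r * sqrt (\<Sum>i<n. (g (\<omega> i))\<^sup>2) \<le> r * (sqrt (real n) * sqrt (I + \<epsilon>))"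
            using r by (rule mult_left_mono)
          moreover have "\<sigma> * sqrt (real n) * ?t = \<sigma> * sqrt (real n) * \<epsilon> + r * (sqrt (real n) * sqrt (I + \<epsilon>))"
            using var by (simp add: field_simps)
          ultimately show ?thesis
            using \<omega> by auto
        qed simp
      qed
      then have "P.prob ?B \<le> P.prob (?F n ?t \<union> ?G n)"
        using meas by (intro P.finite_measure_mono) auto
      also have "\<dots> \<le> P.prob (?F n ?t) + P.prob (?G n)"
        by (rule measure_Un_le[OF meas])
      finally show ?case .
    qed
    moreover have "(\<lambda>n. P.prob (?F n ?t) + P.prob (?G n)) \<longlonglongrightarrow> cdf std_normal_distribution ?t + 0"
      using weak_law_upper[OF g(1) _ \<epsilon>] by (intro tendsto_add clt) (simp_all add: I_def)
    ultimately have "1 - a \<le> cdf std_normal_distribution ?t + 0"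
      using tendsto_lowerbound sequentially_bot by blast
    then show ?thesis
      by simp
  qed
  have "((\<lambda>\<epsilon>. cdf std_normal_distribution (\<epsilon> + r * sqrt (I + \<epsilon>) / \<sigma>)) \<longlongrightarrow>
      cdf std_normal_distribution (0 + r * sqrt (I + 0) / \<sigma>)) (at_right 0)"
    by (rule isCont_tendsto_compose[OF isCont_cdf_std_normal]) (intro tendsto_intros, use var in auto)
  moreover have "\<forall>\<^sub>F \<epsilon> in at_right 0. 1 - a \<le> cdf std_normal_distribution (\<epsilon> + r * sqrt (I + \<epsilon>) / \<sigma>)"
    using eventually_at_right_less[of "0::real"] by eventually_elim (rule step)
  ultimately have "1 - a \<le> cdf std_normal_distribution (0 + r * sqrt (I + 0) / \<sigma>)"
    using tendsto_lowerbound trivial_limit_at_right_real by blast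
  then show ?thesis
    by (simp add: gauss_tail_eq_cdf I_def)
qed

end

section \<open>The convex Poincare inequality\<close>

text \<open>
  The measure of the enlargement is not computed: the enlargement is contained in the measurable set of the
  conclusion, so the lower bound passes to that set.
\<close>

lemma CCI2_inf_sum_sublevel:
  fixes \<mu> :: "'a::metric_space measure" and f g :: "'a \<Rightarrow> real" and n :: nat
  assumes \<mu>: "prob_space \<mu>" "sets \<mu> = sets borel" and cci: "CCI2_inf \<mu> \<alpha>"
    and f: "geod_convex_fun UNIV dist f" "f \<in> borel_measurable borel"
    and g: "g \<in> borel_measurable borel" "\<And>x y. f x - f y \<le> g x * dist x y"
    and n: "n \<ge> 1" and r: "r \<ge> 0"
    and half: "1 / 2 \<le> measure (Pi\<^sub>M {..<n} (\<lambda>_. \<mu>)) {x \<in> space (Pi\<^sub>M {..<n} (\<lambda>_. \<mu>)). (\<Sum>i<n. f (x i)) \<le> c}"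
  shows "1 - \<alpha> r \<le> measure (Pi\<^sub>M {..<n} (\<lambda>_. \<mu>))
    {x \<in> space (Pi\<^sub>M {..<n} (\<lambda>_. \<mu>)). (\<Sum>i<n. f (x i)) \<le> c + r * sqrt (\<Sum>i<n. (g (x i))\<^sup>2)}"
proof -
  let ?P = "Pi\<^sub>M {..<n} (\<lambda>_. \<mu>)"
  let ?A = "{x \<in> space ?P. (\<Sum>i<n. f (x i)) \<le> c}"
  let ?B = "{x \<in> space ?P. (\<Sum>i<n. f (x i)) \<le> c + r * sqrt (\<Sum>i<n. (g (x i))\<^sup>2)}"
  interpret P: prob_space ?P
    by (intro prob_space_PiM \<mu>)
  have [measurable]: "f \<in> borel_measurable \<mu>" "g \<in> borel_measurable \<mu>"
    using f g \<mu>(2) by (auto cong: measurable_cong_sets)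
  have space: "space ?P = ({..<n} \<rightarrow>\<^sub>E UNIV)"
    using sets_eq_imp_space_eq[OF \<mu>(2)] by (simp add: space_PiM)
  have "sets (Pi\<^sub>M {..<n} (\<lambda>_. borel)) = sets ?P"
    by (intro sets_PiM_cong) (simp_all add: \<mu>(2))
  moreover have meas: "?A \<in> sets ?P" "?B \<in> sets ?P"
    by measurable
  moreover have "geod_convex_set ({..<n} \<rightarrow>\<^sub>E UNIV) (dist2 n) ?A"
    unfolding space by (rule geod_convex_set_sum_sublevel[OF f(1)])
  ultimately have "1 - \<alpha> r \<le> P.prob (enlargement2 n ?A r)"
    using cci n r half unfolding CCI2_inf_def by blast
  also have "enlargement2 n ?A r \<subseteq> ?B"
  proof
    have "?A \<noteq> {}"
    proof
      assume "?A = {}"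
      with half have "1 / 2 \<le> P.prob {}"
        by (simp only:)
      then show False
        by simp
    qed
    fix x assume x: "x \<in> enlargement2 n ?A r"
    have "(\<Sum>i<n. f (x i)) \<le> c + r * sqrt (\<Sum>i<n. (g (x i))\<^sup>2)"
      by (rule sum_le_on_enlargement[OF g(2) \<open>?A \<noteq> {}\<close> _ x]) simp
    with x show "x \<in> ?B"
      by (simp add: space enlargement2_def)
  qed
  then have "P.prob (enlargement2 n ?A r) \<le> P.prob ?B"
    using meas by (intro P.finite_measure_mono)
  finally show ?thesis .
qed

text \<open>
  Since \<open>gauss_tail\<close> is positive, the hypothesis excludes \<open>\<alpha> r = 0\<close>, hence the infinite value of the inverse,
  for every \<open>r > 0\<close>.
\<close>

lemma sqrt_poincare_const_le:
  assumes nonneg: "\<And>r. r \<ge> 0 \<Longrightarrow> \<alpha> r \<ge> 0"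
    and tail: "\<And>r. r > 0 \<Longrightarrow> gauss_tail (r * K) \<le> \<alpha> r"
  shows "sqrt_poincare_const \<alpha> \<le> ennreal K"
  unfolding sqrt_poincare_const_def
proof (rule Sup_least, clarify)
  fix r :: real assume r: "r > 0" "\<alpha> r \<le> 1 / 2"
  have pos: "0 < \<alpha> r"
    using tail[OF r(1)] gauss_tail_pos[of "r * K"] by linarith
  then have "gauss_tail (inv gauss_tail (\<alpha> r)) = \<alpha> r"
    using r by (intro gauss_tail_inv_into) auto
  then have "\<not> gauss_tail (inv gauss_tail (\<alpha> r)) < gauss_tail (r * K)"
    using tail[OF r(1)] by simp
  then have "inv gauss_tail (\<alpha> r) / r \<le> K"
    using r by (simp add: gauss_tail_less_iff divide_simps mult.commute)
  then show "e2ennreal (gauss_tail_inv (\<alpha> r) / ereal r) \<le> ennreal K"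
    using pos r by (simp add: gauss_tail_inv_def e2ennreal_ereal ennreal_leI)
qed

lemma (in prob_space) finite_variance_iff:
  assumes [measurable]: "f \<in> borel_measurable M"
  shows "finite_variance M f \<longleftrightarrow> integrable M (\<lambda>x. (f x)\<^sup>2)"
proof
  assume "finite_variance M f"
  then have "integrable M f" "integrable M (\<lambda>x. (f x - expectation f)\<^sup>2)"
    by (auto simp: finite_variance_def)
  then have "integrable M (\<lambda>x. (f x - expectation f)\<^sup>2 + 2 * expectation f * f x - (expectation f)\<^sup>2)"
    by auto
  then show "integrable M (\<lambda>x. (f x)\<^sup>2)"
    by (simp add: power2_diff mult_ac)
next
  assume sq: "integrable M (\<lambda>x. (f x)\<^sup>2)"
  then have "integrable M f"
    by (rule square_integrable_imp_integrable[rotated]) simp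
  moreover from this sq have "integrable M (\<lambda>x. (f x - expectation f)\<^sup>2)"
    by (simp add: power2_diff)
  ultimately show "finite_variance M f"
    by (simp add: finite_variance_def)
qed

text \<open>
  If the variance vanishes or the integral of the squared slope is infinite, there is nothing to prove. Otherwise
  the limit of the concentration inequality bounds every member of the supremum that defines the constant by
  \<open>sqrt I / \<sigma>\<close>.
\<close>

theorem convex_poincare_inequality:
  fixes \<mu> :: "'a::metric_space measure" and f :: "'a \<Rightarrow> real"
  assumes geo: "geodesic_metric (UNIV :: 'a set) dist"
    and \<mu>: "prob_space \<mu>" "sets \<mu> = sets borel"
    and nonneg: "\<And>r. r \<ge> 0 \<Longrightarrow> \<alpha> r \<ge> 0" and cci: "CCI2_inf \<mu> \<alpha>"
    and f: "lipschitz_on_balls f" "geod_convex_fun UNIV dist f" "finite_variance \<mu> f"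
  shows "poincare_const \<alpha> * ennreal (prob_space.variance \<mu> f) \<le> (\<integral>\<^sup>+x. (descending_slope f x)\<^sup>2 \<partial>\<mu>)"
proof (cases "prob_space.variance \<mu> f = 0 \<or> (\<integral>\<^sup>+x. (descending_slope f x)\<^sup>2 \<partial>\<mu>) = \<infinity>")
  case False
  interpret prob_space \<mu>
    by fact
  define \<sigma> g where "\<sigma> = sqrt (variance f)" and "g = (\<lambda>x. enn2real (descending_slope f x))"
  have var: "variance f = \<sigma>\<^sup>2" "\<sigma> > 0"
    using False by (auto simp: \<sigma>_def less_le Bochner_Integration.integral_nonneg)
  have f_meas: "f \<in> borel_measurable borel"
    by (intro borel_measurable_continuous_onI lipschitz_on_balls_imp_continuous f)
  have g_meas: "g \<in> borel_measurable borel"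
    unfolding g_def using descending_slope_measurable[OF geo f(2,1)] by measurable
  have meas [measurable]: "f \<in> borel_measurable \<mu>" "g \<in> borel_measurable \<mu>"
    using f_meas g_meas \<mu>(2) by (auto cong: measurable_cong_sets)
  have slope: "(descending_slope f x)\<^sup>2 = ennreal ((g x)\<^sup>2)" for x
    using descending_slope_finite[OF f(1), of x] by (simp add: g_def ennreal_power[symmetric])
  then have "(\<integral>\<^sup>+x. ennreal ((g x)\<^sup>2) \<partial>\<mu>) \<noteq> \<infinity>"
    using False by simp
  then have g_int: "integrable \<mu> (\<lambda>x. (g x)\<^sup>2)"
    by (intro integrableI_nonneg) (auto simp: top.not_eq_extremum)
  define I where "I = expectation (\<lambda>x. (g x)\<^sup>2)"
  have I: "I \<ge> 0" "(\<integral>\<^sup>+x. (descending_slope f x)\<^sup>2 \<partial>\<mu>) = ennreal I"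
    using g_int by (simp_all add: slope I_def nn_integral_eq_integral)
  have f_int: "integrable \<mu> f" "integrable \<mu> (\<lambda>x. (f x)\<^sup>2)"
    using f(3) finite_variance_iff[of f] meas by (auto simp: finite_variance_def)
  have "gauss_tail (r * (sqrt I / \<sigma>)) \<le> \<alpha> r" if "r > 0" for r
    unfolding I_def times_divide_eq_right
  proof (rule gauss_tail_le_of_concentration[OF f_int var g_int meas(2)])
    have "f x - f y \<le> g x * dist x y" for x y
      unfolding g_def by (rule descending_slope_supports[OF geo f(2,1)])
    note conc = CCI2_inf_sum_sublevel[OF \<mu> cci f(2) f_meas g_meas this]
    show "1 - \<alpha> r \<le> measure (Pi\<^sub>M {..<n} (\<lambda>_. \<mu>))
        {x \<in> space (Pi\<^sub>M {..<n} (\<lambda>_. \<mu>)). (\<Sum>i<n. f (x i)) \<le> c + r * sqrt (\<Sum>i<n. (g (x i))\<^sup>2)}"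
      if "n \<ge> 1" "1 / 2 \<le> measure (Pi\<^sub>M {..<n} (\<lambda>_. \<mu>))
        {x \<in> space (Pi\<^sub>M {..<n} (\<lambda>_. \<mu>)). (\<Sum>i<n. f (x i)) \<le> c}" for n :: nat and c
      by (rule conc) (use that \<open>r > 0\<close> in simp_all)
  qed (use that in simp)
  then have "sqrt_poincare_const \<alpha> \<le> ennreal (sqrt I / \<sigma>)"
    by (intro sqrt_poincare_const_le nonneg)
  then have "poincare_const \<alpha> \<le> (ennreal (sqrt I / \<sigma>))\<^sup>2"
    unfolding poincare_const_def by (rule power_mono) simp
  also have "\<dots> = ennreal (I / \<sigma>\<^sup>2)"
    using I var by (simp add: ennreal_power power_divide)
  finally have "poincare_const \<alpha> * ennreal (variance f) \<le> ennreal (I / \<sigma>\<^sup>2) * ennreal (\<sigma>\<^sup>2)"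
    unfolding var by (rule mult_right_mono) simp
  also have "\<dots> = ennreal I"
    using I var by (simp add: ennreal_mult[symmetric])
  finally show ?thesis
    using I by simp
qed auto

section \<open>Finite variance of Lipschitz functions\<close>

text \<open>
  The square of \<open>max (Y x) 0\<close> is \<open>2 K\<^sup>2\<close> times the integral of \<open>r\<close> over \<open>0 \<le> r \<le> max (Y x) 0 / K\<close>; exchanging
  the integrals turns the second moment into the integral of \<open>r\<close> against the tail probabilities.
\<close>

lemma (in prob_space) second_moment_of_upper_tail:
  fixes Y :: "'a \<Rightarrow> real"
  assumes [measurable]: "Y \<in> borel_measurable M" and K: "K > 0"
    and tail: "\<And>r. r > 0 \<Longrightarrow> prob {x \<in> space M. Y x \<ge> K * r} \<le> \<alpha> r"
    and fin: "(\<integral>\<^sup>+r\<in>{0..}. ennreal (r * \<alpha> r) \<partial>lborel) < \<infinity>"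
  shows "integrable M (\<lambda>x. (max (Y x) 0)\<^sup>2)"
proof -
  interpret pair_sigma_finite lborel M ..
  let ?u = "\<lambda>x. max (Y x) 0 / K"
  have layers: "ennreal ((max (Y x) 0)\<^sup>2) = ennreal (2 * K\<^sup>2) * (\<integral>\<^sup>+r. ennreal r * indicator {0..?u x} r \<partial>lborel)" for x
  proof -
    have "(\<integral>\<^sup>+r. ennreal r * indicator {0..?u x} r \<partial>lborel) = ennreal ((?u x)\<^sup>2 / 2 - 0\<^sup>2 / 2)"
      using K by (intro nn_integral_FTC_Icc) (auto intro!: derivative_eq_intros)
    then show ?thesis
      using K by (simp add: ennreal_mult[symmetric] power_divide)
  qed
  have "(\<integral>\<^sup>+x. (\<integral>\<^sup>+r. ennreal r * indicator {0..?u x} r \<partial>lborel) \<partial>M)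
      = (\<integral>\<^sup>+r. (\<integral>\<^sup>+x. ennreal r * indicator {0..?u x} r \<partial>M) \<partial>lborel)"
    by (rule Fubini') (unfold indicator_def atLeastAtMost_iff, measurable)
  also have "\<dots> \<le> (\<integral>\<^sup>+r\<in>{0..}. ennreal (r * \<alpha> r) \<partial>lborel)"
  proof (rule nn_integral_mono)
    fix r :: real
    show "(\<integral>\<^sup>+x. ennreal r * indicator {0..?u x} r \<partial>M) \<le> ennreal (r * \<alpha> r) * indicator {0..} r"
    proof (cases "r > 0")
      case True
      have "(\<integral>\<^sup>+x. ennreal r * indicator {0..?u x} r \<partial>M)
          = (\<integral>\<^sup>+x. ennreal r * indicator {x \<in> space M. Y x \<ge> K * r} x \<partial>M)"
      proof (rule nn_integral_cong)
        fix x assume "x \<in> space M"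
        moreover have "r \<le> ?u x \<longleftrightarrow> K * r \<le> Y x"
          using mult_pos_pos[OF K True] K by (simp add: pos_le_divide_eq mult.commute le_max_iff_disj)
        ultimately show "ennreal r * indicator {0..?u x} r = ennreal r * indicator {x \<in> space M. Y x \<ge> K * r} x"
          using True by (simp add: indicator_def)
      qed
      also have "\<dots> = ennreal r * emeasure M {x \<in> space M. Y x \<ge> K * r}"
        by (subst nn_integral_cmult_indicator) auto
      also have "\<dots> = ennreal (r * prob {x \<in> space M. Y x \<ge> K * r})"
        using True by (simp add: emeasure_eq_measure ennreal_mult)
      also have "\<dots> \<le> ennreal (r * \<alpha> r)"
        using True tail[OF True] by (intro ennreal_leI mult_left_mono) auto
      finally show ?thesis
        using True by simp
    qed (simp add: ennreal_neg)
  qed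
  finally have "(\<integral>\<^sup>+x. (\<integral>\<^sup>+r. ennreal r * indicator {0..?u x} r \<partial>lborel) \<partial>M) < \<infinity>"
    using fin by (rule le_less_trans)
  moreover have "(\<integral>\<^sup>+x. ennreal ((max (Y x) 0)\<^sup>2) \<partial>M)
      = ennreal (2 * K\<^sup>2) * (\<integral>\<^sup>+x. (\<integral>\<^sup>+r. ennreal r * indicator {0..?u x} r \<partial>lborel) \<partial>M)"
    unfolding layers
    by (rule nn_integral_cmult, unfold indicator_def atLeastAtMost_iff, measurable)
  ultimately have "(\<integral>\<^sup>+x. ennreal ((max (Y x) 0)\<^sup>2) \<partial>M) < \<infinity>"
    by (simp add: ennreal_mult_less_top)
  then show ?thesis
    by (intro integrableI_nonneg) auto
qed

text \<open>
  If \<open>\<alpha>\<close> stayed above \<open>gauss_tail 1\<close>, the integral of \<open>r * \<alpha> r\<close> would diverge. At an \<open>r\<close> with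
  \<open>\<alpha> r \<le> gauss_tail 1\<close> the inverse is at least \<open>1\<close>, so this \<open>r\<close> contributes at least \<open>1 / r\<close> to the
  supremum.
\<close>

lemma poincare_const_pos:
  assumes nonneg: "\<And>r. r \<ge> 0 \<Longrightarrow> \<alpha> r \<ge> 0"
    and fin: "(\<integral>\<^sup>+r\<in>{0..}. ennreal (r * \<alpha> r) \<partial>lborel) < \<infinity>"
  obtains \<kappa> where "\<kappa> > 0" "ennreal \<kappa> \<le> poincare_const \<alpha>"
proof -
  have "\<exists>r>0. \<alpha> r \<le> gauss_tail 1"
  proof (rule ccontr)
    assume "\<not> (\<exists>r>0. \<alpha> r \<le> gauss_tail 1)"
    then have large: "gauss_tail 1 < \<alpha> r" if "r > 0" for r
      using that by force
    have "emeasure lborel {1::real..} = \<infinity>"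
    proof (rule ccontr)
      assume "emeasure lborel {1::real..} \<noteq> \<infinity>"
      then obtain l where l: "l \<ge> 0" "emeasure lborel {1::real..} = ennreal l"
        by (cases "emeasure lborel {1::real..}") auto
      have "emeasure lborel {1..l + 2} \<le> emeasure lborel {1::real..}"
        by (rule emeasure_mono) auto
      with l show False
        by simp
    qed
    then have "(\<infinity>::ennreal) = (\<integral>\<^sup>+r. ennreal (gauss_tail 1) * indicator {1::real..} r \<partial>lborel)"
      using gauss_tail_pos[of 1] by (subst nn_integral_cmult_indicator) (simp_all add: ennreal_mult_top)
    also have "\<dots> \<le> (\<integral>\<^sup>+r\<in>{0..}. ennreal (r * \<alpha> r) \<partial>lborel)"
    proof (rule nn_integral_mono)
      fix r :: real
      show "ennreal (gauss_tail 1) * indicator {1..} r \<le> ennreal (r * \<alpha> r) * indicator {0..} r"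
      proof (cases "r \<ge> 1")
        case True
        then have "1 * gauss_tail 1 \<le> r * \<alpha> r"
          using large[of r] gauss_tail_pos[of 1] by (intro mult_mono) auto
        then show ?thesis
          using True by (simp add: ennreal_leI)
      qed simp
    qed
    finally show False
      using fin by simp
  qed
  then obtain r where r: "r > 0" "\<alpha> r \<le> gauss_tail 1"
    by blast
  have half: "gauss_tail 1 < 1 / 2"
    using gauss_tail_less_iff[of 1 0] gauss_tail_eq_cdf[of 0] cdf_std_normal_0 by simp
  have "ennreal (1 / r) \<le> e2ennreal (gauss_tail_inv (\<alpha> r) / ereal r)"
  proof (cases "\<alpha> r = 0")
    case False
    then have "gauss_tail (inv gauss_tail (\<alpha> r)) = \<alpha> r"
      using nonneg[of r] r half by (intro gauss_tail_inv_into) auto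
    then have "\<not> gauss_tail 1 < gauss_tail (inv gauss_tail (\<alpha> r))"
      using r by simp
    then have "1 / r \<le> inv gauss_tail (\<alpha> r) / r"
      using r by (simp add: gauss_tail_less_iff divide_right_mono)
    then show ?thesis
      using False r by (simp add: gauss_tail_inv_def e2ennreal_ereal ennreal_leI)
  qed (use r in \<open>simp add: gauss_tail_inv_def\<close>)
  also have "\<dots> \<le> sqrt_poincare_const \<alpha>"
    unfolding sqrt_poincare_const_def using r half by (intro Sup_upper) auto
  finally have "(ennreal (1 / r))\<^sup>2 \<le> poincare_const \<alpha>"
    unfolding poincare_const_def by (rule power_mono) simp
  then show ?thesis
    using r by (intro that[of "(1 / r)\<^sup>2"]) (simp_all add: ennreal_power)
qed

text \<open>
  A mean far outside \<open>[-b, b]\<close> would, by Chebyshev's inequality, leave at most half of the mass in that interval.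
\<close>

lemma (in prob_space) second_moment_le_of_variance:
  fixes Y :: "'a \<Rightarrow> real"
  assumes [measurable]: "Y \<in> borel_measurable M" and Y: "integrable M (\<lambda>x. (Y x)\<^sup>2)" "variance Y \<le> C"
    and b: "prob {x \<in> space M. \<bar>Y x\<bar> \<le> b} > 1 / 2" "b \<ge> 0"
  shows "expectation (\<lambda>x. (Y x)\<^sup>2) \<le> C + (b + sqrt (2 * C))\<^sup>2"
proof -
  have C: "C \<ge> 0"
    using Y(2) variance_positive[of Y] by linarith
  have "\<bar>expectation Y\<bar> \<le> b + sqrt (2 * C)"
  proof (rule ccontr)
    assume "\<not> ?thesis"
    then have far: "\<bar>expectation Y\<bar> - b > sqrt (2 * C)"
      by simp
    define s where "s = \<bar>expectation Y\<bar> - b"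
    have s: "s > 0"
      using far C real_sqrt_ge_zero[of "2 * C"] unfolding s_def by linarith
    have "s\<^sup>2 > 2 * C"
      using power_strict_mono[OF far, of 2] C by (simp add: s_def)
    have "1 / 2 < prob {x \<in> space M. \<bar>Y x\<bar> \<le> b}"
      by (rule b)
    also have "\<dots> \<le> prob {x \<in> space M. \<bar>Y x - expectation Y\<bar> \<ge> s}"
      unfolding s_def by (intro finite_measure_mono) auto
    also have "\<dots> \<le> variance Y / s\<^sup>2"
      using s by (intro Chebyshev_inequality Y) auto
    also have "\<dots> \<le> 1 / 2"
      using s \<open>s\<^sup>2 > 2 * C\<close> Y(2) by (simp add: divide_simps)
    finally show False
      by simp
  qed
  then have "\<bar>expectation Y\<bar>\<^sup>2 \<le> (b + sqrt (2 * C))\<^sup>2"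
    by (rule power_mono) simp
  moreover have "variance Y = expectation (\<lambda>x. (Y x)\<^sup>2) - (expectation Y)\<^sup>2"
    by (rule variance_eq[OF square_integrable_imp_integrable[OF assms(1) Y(1)] Y(1)])
  ultimately show ?thesis
    using Y(2) by simp
qed

text \<open>
  A level \<open>b\<close> with \<open>\<bar>f\<bar> \<le> b\<close> on more than half of the mass serves twice: as the level to which the
  one-dimensional concentration is applied, and, since the truncations below \<open>- b\<close> do not change \<open>f\<close>
  on that event, to bound the means of all truncations at once.
\<close>

theorem finite_variance_of_lipschitz:
  fixes \<mu> :: "'a::metric_space measure" and f :: "'a \<Rightarrow> real"
  assumes geo: "geodesic_metric (UNIV :: 'a set) dist"
    and \<mu>: "prob_space \<mu>" "sets \<mu> = sets borel"
    and nonneg: "\<And>r. r \<ge> 0 \<Longrightarrow> \<alpha> r \<ge> 0" and cci: "CCI2_inf \<mu> \<alpha>"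
    and fin: "(\<integral>\<^sup>+r\<in>{0..}. ennreal (r * \<alpha> r) \<partial>lborel) < \<infinity>"
    and f: "L-lipschitz_on UNIV f" "geod_convex_fun UNIV dist f"
  shows "finite_variance \<mu> f"
proof -
  interpret prob_space \<mu>
    by fact
  \<comment> \<open>A positive Lipschitz constant, since \<open>L = 0\<close> is possible and tails are measured in units of \<open>K\<close>.\<close>
  define K where "K = L + 1"
  have K: "K > 0" "L \<le> K"
    using lipschitz_on_nonneg[OF f(1)] by (auto simp: K_def)
  have f_meas: "f \<in> borel_measurable borel"
    using lipschitz_on_continuous_on[OF f(1)] by (rule borel_measurable_continuous_onI)
  then have [measurable]: "f \<in> borel_measurable \<mu>"
    using \<mu>(2) by (auto cong: measurable_cong_sets)
  obtain b :: nat where b: "prob {x \<in> space \<mu>. \<bar>f x\<bar> \<le> real b} > 1 / 2"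
  proof -
    interpret D: real_distribution "distr \<mu> borel (\<lambda>x. \<bar>f x\<bar>)"
      by (rule real_distribution_distr) simp
    have "\<forall>\<^sub>F n in sequentially. 1 / 2 < cdf (distr \<mu> borel (\<lambda>x. \<bar>f x\<bar>)) (real n)"
      by (rule order_tendstoD(1)[OF D.cdf_lim_infty_prob]) simp
    then obtain n :: nat where "1 / 2 < cdf (distr \<mu> borel (\<lambda>x. \<bar>f x\<bar>)) (real n)"
      by (auto simp: eventually_at_top_linorder)
    also have "\<dots> = prob {x \<in> space \<mu>. \<bar>f x\<bar> \<le> real n}"
      unfolding cdf_def by (subst measure_distr) (auto intro!: arg_cong[where f=prob])
    finally show ?thesis
      by (rule that)
  qed
  \<comment> \<open>The factor \<open>2\<close> absorbs the difference between \<open>\<ge>\<close> and the strict inequality that concentration gives.\<close>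
  have upper: "prob {x \<in> space \<mu>. f x - real b \<ge> 2 * K * r} \<le> \<alpha> r" if r: "r > 0" for r
  proof -
    have coord: "measure (Pi\<^sub>M {..<1::nat} (\<lambda>_. \<mu>)) {x \<in> space (Pi\<^sub>M {..<1::nat} (\<lambda>_. \<mu>)). (\<Sum>i<1. f (x i)) \<le> c}
        = prob {x \<in> space \<mu>. f x \<le> c}" for c
    proof -
      have "prob {x \<in> space \<mu>. f x \<le> c}
          = measure (distr (Pi\<^sub>M {..<1} (\<lambda>_. \<mu>)) \<mu> (\<lambda>x. x (0::nat))) {x \<in> space \<mu>. f x \<le> c}"
        by (subst distr_PiM_component) (auto simp: prob_space_axioms)
      also have "\<dots> = measure (Pi\<^sub>M {..<1} (\<lambda>_. \<mu>)) ((\<lambda>x. x (0::nat)) -` {x \<in> space \<mu>. f x \<le> c} \<inter> space (Pi\<^sub>M {..<1} (\<lambda>_. \<mu>)))"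
        by (subst measure_distr) auto
      also have "(\<lambda>x. x (0::nat)) -` {x \<in> space \<mu>. f x \<le> c} \<inter> space (Pi\<^sub>M {..<1} (\<lambda>_. \<mu>))
          = {x \<in> space (Pi\<^sub>M {..<1} (\<lambda>_. \<mu>)). (\<Sum>i<1. f (x i)) \<le> c}"
        by (auto simp: space_PiM)
      finally show ?thesis ..
    qed
    have "1 / 2 \<le> prob {x \<in> space \<mu>. \<bar>f x\<bar> \<le> real b}"
      using b by simp
    also have "\<dots> \<le> prob {x \<in> space \<mu>. f x \<le> real b}"
      by (intro finite_measure_mono) auto
    finally have half: "1 / 2 \<le> prob {x \<in> space \<mu>. f x \<le> real b}" .
    have "f x - f y \<le> K * dist x y" for x y
    proof -
      have "f x - f y \<le> L * dist x y"
        using lipschitz_onD[OF f(1), of x y] by (simp add: dist_real_def)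
      also have "\<dots> \<le> K * dist x y"
        using K by (intro mult_right_mono) auto
      finally show ?thesis .
    qed
    from CCI2_inf_sum_sublevel[OF \<mu> cci f(2) f_meas _ this, of 1 r "real b"]
    have "1 - \<alpha> r \<le> prob {x \<in> space \<mu>. f x \<le> real b + r * K}"
      using half r K coord[of "real b"] coord[of "real b + r * K"] by simp
    also have "\<dots> = 1 - prob {x \<in> space \<mu>. \<not> f x \<le> real b + r * K}"
      by (subst prob_neg) auto
    finally have "prob {x \<in> space \<mu>. \<not> f x \<le> real b + r * K} \<le> \<alpha> r"
      by simp
    moreover have "prob {x \<in> space \<mu>. f x - real b \<ge> 2 * K * r} \<le> prob {x \<in> space \<mu>. \<not> f x \<le> real b + r * K}"
    proof (intro finite_measure_mono subsetI)
      fix x assume "x \<in> {x \<in> space \<mu>. f x - real b \<ge> 2 * K * r}"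
      moreover have "K * r > 0"
        using K r by simp
      ultimately show "x \<in> {x \<in> space \<mu>. \<not> f x \<le> real b + r * K}"
        by (auto simp: algebra_simps)
    qed simp
    ultimately show ?thesis
      by simp
  qed
  have upper_int: "integrable \<mu> (\<lambda>x. (max (f x - real b) 0)\<^sup>2)"
    using K by (intro second_moment_of_upper_tail[OF _ _ upper fin]) auto
  obtain \<kappa> where \<kappa>: "\<kappa> > 0" "ennreal \<kappa> \<le> poincare_const \<alpha>"
    using poincare_const_pos[OF nonneg fin] .
  \<comment> \<open>The truncation levels start at \<open>b\<close>, so that \<open>F j\<close> agrees with \<open>f\<close> wherever \<open>\<bar>f\<bar> \<le> b\<close>.\<close>
  define F C where "F = (\<lambda>j x. max (f x) (- real (b + j)))" and "C = L\<^sup>2 / \<kappa>"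
  have F_meas [measurable]: "F j \<in> borel_measurable \<mu>" for j
    unfolding F_def by measurable
  have F_sq: "integrable \<mu> (\<lambda>x. (F j x)\<^sup>2)" for j
  proof (rule Bochner_Integration.integrable_bound)
    show "integrable \<mu> (\<lambda>x. 2 * (max (f x - real b) 0)\<^sup>2 + 2 * (real (b + j))\<^sup>2)"
      using upper_int by auto
    show "AE x in \<mu>. norm ((F j x)\<^sup>2) \<le> norm (2 * (max (f x - real b) 0)\<^sup>2 + 2 * (real (b + j))\<^sup>2)"
    proof (rule AE_I2)
      fix x
      let ?p = "max (f x - real b) 0" and ?q = "real (b + j)"
      have "\<bar>F j x\<bar> \<le> ?p + ?q"
        unfolding F_def by auto
      then have "(F j x)\<^sup>2 \<le> (?p + ?q)\<^sup>2"
        using power_mono[of "\<bar>F j x\<bar>" "?p + ?q" 2] by simp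
      also have "\<dots> \<le> 2 * ?p\<^sup>2 + 2 * ?q\<^sup>2"
        using sum_squares_bound[of ?p ?q] by (simp add: power2_sum)
      finally show "norm ((F j x)\<^sup>2) \<le> norm (2 * ?p\<^sup>2 + 2 * ?q\<^sup>2)"
        by simp
    qed
  qed simp
  have F_lip: "L-lipschitz_on UNIV (F j)" for j
  proof (rule lipschitz_onI)
    fix x y
    have "dist (F j x) (F j y) \<le> dist (f x) (f y)"
      by (auto simp: F_def dist_real_def max_def)
    also have "\<dots> \<le> L * dist x y"
      by (rule lipschitz_onD[OF f(1)]) auto
    finally show "dist (F j x) (F j y) \<le> L * dist x y" .
  qed (rule lipschitz_on_nonneg[OF f(1)])
  have F_convex: "geod_convex_fun UNIV dist (F j)" for j
    unfolding geod_convex_fun_def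
  proof (intro allI impI ballI)
    fix \<gamma> :: "real \<Rightarrow> 'a" and t :: real assume \<gamma>: "geodesic_curve UNIV dist \<gamma>" and t: "t \<in> {0..1}"
    then have "f (\<gamma> t) \<le> (1 - t) * f (\<gamma> 0) + t * f (\<gamma> 1)"
      using f(2) unfolding geod_convex_fun_def by blast
    also have "\<dots> \<le> (1 - t) * F j (\<gamma> 0) + t * F j (\<gamma> 1)"
      using t by (intro add_mono mult_left_mono) (auto simp: F_def)
    finally have 1: "f (\<gamma> t) \<le> (1 - t) * F j (\<gamma> 0) + t * F j (\<gamma> 1)" .
    have "- real (b + j) = (1 - t) * - real (b + j) + t * - real (b + j)"
      by (simp add: algebra_simps)
    also have "\<dots> \<le> (1 - t) * F j (\<gamma> 0) + t * F j (\<gamma> 1)"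
      using t by (intro add_mono mult_left_mono) (auto simp: F_def)
    finally show "F j (\<gamma> t) \<le> (1 - t) * F j (\<gamma> 0) + t * F j (\<gamma> 1)"
      using 1 by (simp add: F_def max_def)
  qed
  have F_var: "variance (F j) \<le> C" for j
  proof -
    have "lipschitz_on_balls (F j)"
      using F_lip[of j] lipschitz_on_subset unfolding lipschitz_on_balls_def by blast
    moreover have "finite_variance \<mu> (F j)"
      using F_sq finite_variance_iff by simp
    ultimately have "poincare_const \<alpha> * ennreal (variance (F j)) \<le> (\<integral>\<^sup>+x. (descending_slope (F j) x)\<^sup>2 \<partial>\<mu>)"
      by (intro convex_poincare_inequality[OF geo \<mu> nonneg cci _ F_convex])
    also have "\<dots> \<le> (\<integral>\<^sup>+x. (ennreal L)\<^sup>2 \<partial>\<mu>)"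
    proof (intro nn_integral_mono power_mono)
      fix x
      show "descending_slope (F j) x \<le> ennreal L"
        using lipschitz_on_subset[OF F_lip] by (intro descending_slope_le_lipschitz[where r=1]) auto
    qed simp
    also have "\<dots> = ennreal (L\<^sup>2)"
      using lipschitz_on_nonneg[OF f(1)] by (simp add: emeasure_space_1 ennreal_power)
    finally have "ennreal \<kappa> * ennreal (variance (F j)) \<le> ennreal (L\<^sup>2)"
      using mult_right_mono[OF \<kappa>(2), of "ennreal (variance (F j))"] by (meson order_trans zero_le)
    then have "\<kappa> * variance (F j) \<le> L\<^sup>2"
      using \<kappa> by (simp add: ennreal_mult'[symmetric])
    then show ?thesis
      using \<kappa> by (simp add: C_def divide_simps mult.commute)
  qed
  have F_moment: "(\<integral>\<^sup>+x. ennreal ((F j x)\<^sup>2) \<partial>\<mu>) \<le> ennreal (C + (real b + sqrt (2 * C))\<^sup>2)" for j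
  proof -
    have "prob {x \<in> space \<mu>. \<bar>f x\<bar> \<le> real b} \<le> prob {x \<in> space \<mu>. \<bar>F j x\<bar> \<le> real b}"
      by (intro finite_measure_mono) (auto simp: F_def)
    then have "1 / 2 < prob {x \<in> space \<mu>. \<bar>F j x\<bar> \<le> real b}"
      using b by linarith
    from second_moment_le_of_variance[OF F_meas F_sq F_var this] show ?thesis
      by (subst nn_integral_eq_integral) (auto simp: F_sq ennreal_leI)
  qed
  have "(\<integral>\<^sup>+x. ennreal ((f x)\<^sup>2) \<partial>\<mu>) = (\<integral>\<^sup>+x. liminf (\<lambda>j. ennreal ((F j x)\<^sup>2)) \<partial>\<mu>)"
  proof (rule nn_integral_cong)
    fix x
    have "\<forall>\<^sub>F j in sequentially. ennreal ((F j x)\<^sup>2) = ennreal ((f x)\<^sup>2)"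
      using eventually_ge_at_top[of "nat \<lceil>- f x\<rceil>"]
    proof eventually_elim
      case (elim j)
      then have "- f x \<le> real j"
        by linarith
      then have "F j x = f x"
        unfolding F_def by (intro max_absorb1) simp
      then show ?case
        by simp
    qed
    then have "(\<lambda>j. ennreal ((F j x)\<^sup>2)) \<longlonglongrightarrow> ennreal ((f x)\<^sup>2)"
      by (rule tendsto_eventually)
    then show "ennreal ((f x)\<^sup>2) = liminf (\<lambda>j. ennreal ((F j x)\<^sup>2))"
      by (rule lim_imp_Liminf[symmetric, rotated]) simp
  qed
  also have "\<dots> \<le> liminf (\<lambda>j. \<integral>\<^sup>+x. ennreal ((F j x)\<^sup>2) \<partial>\<mu>)"
    by (rule nn_integral_liminf) simp
  also have "\<dots> \<le> limsup (\<lambda>j. \<integral>\<^sup>+x. ennreal ((F j x)\<^sup>2) \<partial>\<mu>)"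
    by (rule Liminf_le_Limsup) simp
  also have "\<dots> \<le> ennreal (C + (real b + sqrt (2 * C))\<^sup>2)"
    by (intro Limsup_bounded always_eventually allI F_moment)
  also have "\<dots> < \<infinity>"
    by simp
  finally have "integrable \<mu> (\<lambda>x. (f x)\<^sup>2)"
    by (intro integrableI_nonneg) auto
  then show ?thesis
    by (simp add: finite_variance_iff)
qed

section \<open>The theorem\<close>

theorem theorem6p7:
  fixes \<mu> :: "'a::polish_space measure" and \<alpha> :: "real \<Rightarrow> real"
  assumes "geodesic_metric (UNIV :: 'a set) dist"
    and "prob_space \<mu>" and "sets \<mu> = sets borel"
    and "\<And>r. r \<ge> 0 \<Longrightarrow> \<alpha> r \<ge> 0" and "antimono_on {0..} \<alpha>"
    and "CCI2_inf \<mu> \<alpha>"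
  shows "(\<forall>f :: 'a \<Rightarrow> real.
            lipschitz_on_balls f \<and> geod_convex_fun UNIV dist f \<and> finite_variance \<mu> f \<longrightarrow>
            poincare_const \<alpha> * ennreal (prob_space.variance \<mu> f)
              \<le> (\<integral>\<^sup>+x. (descending_slope f x)\<^sup>2 \<partial>\<mu>)) \<and>
         ((\<integral>\<^sup>+r\<in>{0..}. ennreal (r * \<alpha> r) \<partial>lborel) < \<infinity> \<longrightarrow>
            (\<forall>f :: 'a \<Rightarrow> real.
               (\<exists>L. L-lipschitz_on UNIV f) \<and> geod_convex_fun UNIV dist f \<longrightarrow>
               finite_variance \<mu> f \<and>
               poincare_const \<alpha> * ennreal (prob_space.variance \<mu> f)
                 \<le> (\<integral>\<^sup>+x. (descending_slope f x)\<^sup>2 \<partial>\<mu>)))"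
proof -
  note poincare = convex_poincare_inequality[OF assms(1-4,6)]
  have "finite_variance \<mu> f \<and>
      poincare_const \<alpha> * ennreal (prob_space.variance \<mu> f) \<le> (\<integral>\<^sup>+x. (descending_slope f x)\<^sup>2 \<partial>\<mu>)"
    if fin: "(\<integral>\<^sup>+r\<in>{0..}. ennreal (r * \<alpha> r) \<partial>lborel) < \<infinity>"
      and f: "L-lipschitz_on UNIV f" "geod_convex_fun UNIV dist f" for f :: "'a \<Rightarrow> real" and L
  proof -
    have "lipschitz_on_balls f"
      using f(1) lipschitz_on_subset unfolding lipschitz_on_balls_def by blast
    moreover have "finite_variance \<mu> f"
      by (rule finite_variance_of_lipschitz[OF assms(1-4,6) fin f])
    ultimately show ?thesis
      using poincare[of f] f(2) by simp
  qed
  then show ?thesis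
    using poincare by (intro conjI allI impI) (elim conjE exE, simp_all)+
qed

end
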